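(* Let $G$ be a $\{C_3,C_5\}$-free graph on $n$ vertices with minimum degree $\delta(G) > n/5$. Then $G$ is homomorphic to $F_k$ for some integer $k\ge 1$.
   Context: $C_\ell$ is the cycle of length $\ell$; $\{C_3,C_5\}$-free means containing neither a triangle nor a 5-cycle as a subgraph. A graph $G$ is homomorphic to $H$ if there is a map $f:V(G)\to V(H)$ with $f(u)f(v)\in E(H)$ whenever $uv\in E(G)$. For an integer $k\ge 1$, $F_k$ is the graph with vertices $x_1,\dots,x_{5k-3}$ in which $x_ix_j$ is an edge if and only if $|i-j|\equiv 1 \pmod 5$; equivalently, it is obtained from a $(5k-3)$-cycle (an edge when $k=1$) by adding all chords joining vertices at distance $5j+1$ along the cycle, $j=0,1,\dots,k-1$. Thus $F_1$ is an edge, $F_2=C_7$, and $F_3$ is the Möbius ladder on 12 vertices. *)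

theory Defs
  imports Complex_Main "Graph_Theory.Pair_Digraph"
begin

text \<open>
  Finite simple graphs are modelled by \<^locale>\<open>pair_graph\<close>: the arc set is a finite, irreflexive,
  symmetric relation on the finite vertex set, and an edge \<open>uv\<close> is the pair of arcs
  \<open>(u,v)\<close>, \<open>(v,u)\<close>.
\<close>

text \<open>
  As each edge is represented by both of its arcs, the out-degree of a vertex is the number of its
  neighbours.  On the graph without vertices \<^term>\<open>Min\<close> is applied to the empty set, so the value
  is unspecified there.
\<close>
definition min_degree :: "'a pair_pre_digraph \<Rightarrow> nat" where
  "min_degree G = Min (out_degree (with_proj G) ` pverts G)"

definition graph_hom :: "'a pair_pre_digraph \<Rightarrow> 'b pair_pre_digraph \<Rightarrow> ('a \<Rightarrow> 'b) \<Rightarrow> bool" where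
  "graph_hom G H f \<longleftrightarrow>
     f ` pverts G \<subseteq> pverts H \<and> (\<forall>(u, v) \<in> parcs G. (f u, f v) \<in> parcs H)"

definition homomorphic_to :: "'a pair_pre_digraph \<Rightarrow> 'b pair_pre_digraph \<Rightarrow> bool" where
  "homomorphic_to G H \<longleftrightarrow> (\<exists>f. graph_hom G H f)"

text \<open>Subgraphs are not required to be induced.\<close>
definition contains_copy :: "'b pair_pre_digraph \<Rightarrow> 'a pair_pre_digraph \<Rightarrow> bool" where
  "contains_copy H G \<longleftrightarrow> (\<exists>f. graph_hom H G f \<and> inj_on f (pverts H))"

text \<open>The cycle \<open>C\<^sub>l\<close>, for \<open>l \<ge> 3\<close>.\<close>
definition cycle_graph :: "nat \<Rightarrow> nat pair_pre_digraph" where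
  "cycle_graph l =
     \<lparr> pverts = {0..<l},
       parcs = {(i, j). i < l \<and> j < l \<and> (j = (i + 1) mod l \<or> i = (j + 1) mod l)} \<rparr>"

text \<open>The graph \<open>F\<^sub>k\<close>, for \<open>k \<ge> 1\<close>, with the number \<open>i\<close> standing for \<open>x\<^sub>i\<close>.\<close>
definition F_graph :: "nat \<Rightarrow> nat pair_pre_digraph" where
  "F_graph k =
     \<lparr> pverts = {1..5 * k - 3},
       parcs = {(i, j). i \<in> {1..5 * k - 3} \<and> j \<in> {1..5 * k - 3} \<and>
                        \<bar>int i - int j\<bar> mod 5 = 1} \<rparr>"

lemma pair_graph_F_graph: "pair_graph (F_graph k)"
proof -
  have "parcs (F_graph k) \<subseteq> {1..5 * k - 3} \<times> {1..5 * k - 3}"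
    by (auto simp: F_graph_def)
  then have "finite (parcs (F_graph k))"
    by (rule finite_subset) simp
  then show ?thesis
    by unfold_locales
      (auto simp: F_graph_def symmetric_def abs_minus_commute intro!: symI)
qed

end

theory Submission
  imports Defs
begin

text \<open>
  Adding edges, we may assume that the graph is edge-maximal; then any two non-adjacent vertices are
  joined by a walk of length 4.  Call two vertices far if they have no common neighbour, as adjacent
  vertices and the ends of a walk of length 3 are.  Since all degrees exceed \<open>n / 5\<close>, any weighted list
  of vertices contains a set of more than a fifth of its weight that has a common neighbour, hence no
  two far members.  Case distinctions that end in a violation of this principle show that every
  hexagon has a long diagonal and then that every vertex has a neighbour on every 7-cycle.

  If \<open>x\<^sub>0, \<dots>, x\<^sub>6\<close> is a 7-cycle (without one the graph is bipartite), this makes the graph without the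
  neighbours of \<open>x\<^sub>0\<close> bipartite, which yields a homomorphism \<open>c\<close> to the 5-cycle.  Direct the edges from
  colour \<open>i\<close> to colour \<open>i + 1\<close>.  By maximality a shortest directed cycle would produce a closed directed
  walk of length 10, on which no vertex has more than two neighbours, contradicting the minimum degree.
  So the orientation is acyclic, and \<open>5 h(v) + c(v)\<close>, with \<open>h(v)\<close> the number of vertices from which \<open>v\<close> is
  reachable, is a homomorphism to some \<open>F\<^sub>k\<close>.
\<close>

subsection \<open>Certificates for case distinctions\<close>

text \<open>
  A certificate refutes a finite configuration of vertices named by integers.  \<open>Split i j v\<close> asks
  whether \<open>i\<close> and \<open>j\<close> have a common neighbour, which is then named \<open>v\<close>; \<open>Edge i j v\<close> whether \<open>i\<close> and \<open>j\<close>
  are adjacent or else joined by a walk of length 4 with new inner vertices \<open>v\<close>, \<open>v + 1\<close>, \<open>v + 2\<close>;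
  \<open>Hex\<close> which long diagonal a closed walk of length 6 has.  A branch ends when two vertices that cannot
  have a common neighbour have one (\<open>Clash\<close>), when a non-edge is an edge (\<open>Nonedge\<close>), or when every set
  of the listed vertices that may have a common neighbour carries at most a fifth of the total weight
  (\<open>Weigh\<close>), which the minimum degree rules out.  The certificates below were found by a computer search.
\<close>

datatype cert =
    Weigh "(int \<times> int) list"
  | Clash int int int
  | Nonedge int int
  | Split int int int cert cert
  | Edge int int int cert cert
  | Hex int int int int int int cert cert cert

type_synonym table = "(int \<times> int list) list"

fun nbs :: "table \<Rightarrow> int \<Rightarrow> int list" where
  "nbs [] i = []"
| "nbs ((k, l) # g) i = (if k = i then l else nbs g i)"

text \<open>Only keys already present are changed, so a fresh vertex gets its own, possibly empty,
  entry first. A pair lost for lack of a key costs information, not soundness.\<close>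

definition join :: "int \<Rightarrow> int \<Rightarrow> table \<Rightarrow> table" where
  "join i j g = map (\<lambda>(k, l). (k, if k = i then j # l else if k = j then i # l else l)) g"

text \<open>The three parts are the recorded far pairs, the neighbours (else a triangle) and the
  ends of walks of length 3 (else a pentagon).\<close>

definition conf :: "table \<Rightarrow> table \<Rightarrow> int \<Rightarrow> int list" where
  "conf g f i = nbs f i @ nbs g i @ concat (map (nbs g) (concat (map (nbs g) (nbs g i))))"

fun weight_sum :: "(int \<times> int \<times> int list) list \<Rightarrow> int" where
  "weight_sum [] = 0"
| "weight_sum ((i, w, c) # xs) = w + weight_sum xs"

fun prune :: "int list \<Rightarrow> (int \<times> int \<times> int list) list \<Rightarrow> (int \<times> int \<times> int list) list" where
  "prune c [] = []"
| "prune c (x # xs) = (if List.member c (fst x) then prune c xs else x # prune c xs)"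

lemma length_prune: "length (prune c xs) \<le> length xs"
  by (induction xs) auto

text \<open>Branch and bound for the heaviest conflict-free selection: stop if all that is left fits
  the bound; otherwise the first entry is left out, or it is taken, which removes the later entries
  in conflict with it.\<close>

function light :: "(int \<times> int \<times> int list) list \<Rightarrow> int \<Rightarrow> bool" where
  "light [] b = (0 \<le> b)"
| "light ((i, w, c) # xs) b =
     (if w + weight_sum xs \<le> b then True else if light xs b then light (prune c xs) (b - w) else False)"
  by pat_completeness auto
termination
  by (relation "measure (\<lambda>(xs, b). length xs)") (auto simp: le_imp_less_Suc length_prune)

text \<open>
  The tables \<open>g\<close>, \<open>f\<close>, \<open>a\<close> list, for each vertex, those adjacent to it, far from it and known to be
  non-adjacent to it; all names in them are below \<open>n\<close>.  The flag \<open>h\<close> permits \<open>Hex\<close>.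
\<close>

fun check :: "bool \<Rightarrow> cert \<Rightarrow> int \<Rightarrow> table \<Rightarrow> table \<Rightarrow> table \<Rightarrow> bool" where
  "check h (Weigh ws) n g f a =
     (let xs = map (\<lambda>(i, w). (i, w, conf g f i)) ws; t = weight_sum xs
      in 0 < t \<and> list_all (\<lambda>(i, w). 0 \<le> w) ws \<and> light xs (t div 5))"
| "check h (Clash i j k) n g f a = (List.member (nbs g i) k \<and> List.member (nbs g j) k \<and> List.member (conf g f i) j)"
| "check h (Nonedge i j) n g f a = (List.member (nbs g i) j \<and> List.member (nbs a i) j)"
| "check h (Split i j v c d) n g f a =
     (i < n \<and> j < n \<and> n \<le> v \<and>
      check h c (v + 1) ((v, [i, j]) # join i v (join j v g)) ((v, []) # f) a \<and>
      check h d n g (join i j f) a)"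
| "check h (Edge i j v c d) n g f a =
     (i < n \<and> j < n \<and> n \<le> v \<and> 
      check h c n (join i j g) f a \<and>
      check h d (v + 3) ((v, [i, v+1]) # (v+1, [v, v+2]) # (v+2, [v+1, j]) # join i v (join j (v+2) g))
         ((v, []) # (v+1,[]) # (v+2,[]) # f) a)"
| "check h (Hex i j k l m q c d e) n g f a =
     (h \<and> List.member (nbs g i) j \<and> List.member (nbs g j) k \<and> List.member (nbs g k) l \<and>
      List.member (nbs g l) m \<and> List.member (nbs g m) q \<and> List.member (nbs g q) i \<and>
      check h c n (join i l g) f a \<and> check h d n (join j m g) f a \<and> check h e n (join k q g) f a)"


section \<open>The minimum degree condition as a weighing principle\<close>

definition far :: "('a \<Rightarrow> 'a \<Rightarrow> bool) \<Rightarrow> 'a \<Rightarrow> 'a \<Rightarrow> bool" where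
  "far adj x y \<longleftrightarrow> (\<nexists>z. adj z x \<and> adj z y)"

text \<open>Short for: no hexagon without a long diagonal. It speaks of closed walks; if for
  instance \<open>a = c\<close>, the diagonal \<open>ad\<close> is the edge
  \<open>cd\<close>.\<close>

definition no_hex :: "('a \<Rightarrow> 'a \<Rightarrow> bool) \<Rightarrow> bool" where
  "no_hex adj \<longleftrightarrow>
     (\<forall>a b c d e f. adj a b \<longrightarrow> adj b c \<longrightarrow> adj c d \<longrightarrow> adj d e \<longrightarrow> adj e f \<longrightarrow> adj f a \<longrightarrow>
        adj a d \<or> adj b e \<or> adj c f)"

text \<open>Triangles and pentagons are excluded as closed walks, so \<open>no_triangle\<close>
  rules out loops as well.\<close>

locale dense_graph =
  fixes V :: "'a set" and adj :: "'a \<Rightarrow> 'a \<Rightarrow> bool"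
  assumes finite_V: "finite V"
    and adj_V: "adj u v \<Longrightarrow> u \<in> V"
    and adj_sym: "adj u v \<Longrightarrow> adj v u"
    and no_triangle: "adj a b \<Longrightarrow> adj b c \<Longrightarrow> \<not> adj c a"
    and no_pentagon: "adj a b \<Longrightarrow> adj b c \<Longrightarrow> adj c d \<Longrightarrow> adj d e \<Longrightarrow> \<not> adj e a"
    and degree: "v \<in> V \<Longrightarrow> card V < 5 * card {u. adj u v}"
begin

lemma far_commute: "far adj x y \<longleftrightarrow> far adj y x"
  by (auto simp: far_def)

lemma adj_far: "adj x y \<Longrightarrow> far adj x y"
  unfolding far_def using no_triangle adj_sym by blast

lemma walk3_far: "adj x y \<Longrightarrow> adj y z \<Longrightarrow> adj z w \<Longrightarrow> far adj x w"
  unfolding far_def using no_pentagon adj_sym by blast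

text \<open>Double counting: \<open>x i\<close> contributes its weight to more than a fifth of all
  vertices, so some vertex receives more than a fifth of the total. The family is indexed because
  different names in a certificate may denote the same vertex.\<close>

lemma heavy_vertex:
  fixes x :: "'b \<Rightarrow> 'a" and w :: "'b \<Rightarrow> int"
  assumes "finite I" and "x ` I \<subseteq> V" and w: "\<And>i. i \<in> I \<Longrightarrow> 0 \<le> w i" and pos: "0 < (\<Sum>i\<in>I. w i)"
  shows "\<exists>v\<in>V. (\<Sum>i\<in>I. w i) < 5 * (\<Sum>i\<in>I. if adj v (x i) then w i else 0)"
proof (rule ccontr)
  assume "\<not> ?thesis"
  then have le: "5 * (\<Sum>i\<in>I. if adj v (x i) then w i else 0) \<le> (\<Sum>i\<in>I. w i)" if "v \<in> V" for v
    using that by force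
  have deg: "{u. adj u y} = {u\<in>V. adj u y}" for y
    using adj_V by blast
  have "(\<Sum>i\<in>I. w i) * int (card V) < (\<Sum>i\<in>I. w i * (5 * int (card {u. adj u (x i)})))"
  proof -
    \<comment> \<open>A single positive weight makes the summed inequality strict.\<close>
    obtain i where i: "i \<in> I" "0 < w i"
      using pos w by (metis less_eq_int_code(1) not_less order.antisym sum_nonpos linorder_not_le)
    have "(\<Sum>i\<in>I. w i * int (card V)) < (\<Sum>i\<in>I. w i * (5 * int (card {u. adj u (x i)})))"
    proof (rule sum_strict_mono_ex1[OF \<open>finite I\<close>])
      show "\<forall>i\<in>I. w i * int (card V) \<le> w i * (5 * int (card {u. adj u (x i)}))"
        using w degree assms(2) by (intro ballI mult_left_mono) (fastforce intro: less_imp_le)+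
      have "int (card V) < 5 * int (card {u. adj u (x i)})"
        using degree[of "x i"] i assms(2) by auto
      then show "\<exists>i\<in>I. w i * int (card V) < w i * (5 * int (card {u. adj u (x i)}))"
        using i by (intro bexI[of _ i]) auto
    qed
    then show ?thesis
      by (simp add: sum_distrib_right)
  qed
  also have "\<dots> = (\<Sum>i\<in>I. \<Sum>v\<in>V. 5 * (if adj v (x i) then w i else 0))"
  proof (rule sum.cong[OF refl])
    fix i
    have "int (card {u. adj u (x i)}) = (\<Sum>v\<in>V. if adj v (x i) then 1 else 0)"
      unfolding deg using finite_V by (simp add: sum.If_cases Int_def)
    then have "w i * (5 * int (card {u. adj u (x i)})) = (\<Sum>v\<in>V. (w i * 5) * (if adj v (x i) then 1 else 0))"
      by (simp add: sum_distrib_left mult_ac)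
    also have "\<dots> = (\<Sum>v\<in>V. 5 * (if adj v (x i) then w i else 0))"
      by (rule sum.cong) auto
    finally show "w i * (5 * int (card {u. adj u (x i)})) = (\<Sum>v\<in>V. 5 * (if adj v (x i) then w i else 0))" .
  qed
  also have "\<dots> = (\<Sum>v\<in>V. 5 * (\<Sum>i\<in>I. if adj v (x i) then w i else 0))"
    by (subst sum.swap) (simp add: sum_distrib_left)
  also have "\<dots> \<le> (\<Sum>v\<in>V. (\<Sum>i\<in>I. w i))"
    by (rule sum_mono) (rule le)
  finally show False
    by simp
qed

end

text \<open>The form in which edge-maximality is used: a new edge \<open>ab\<close> would close a
  pentagon or a triangle, and a path of length 2 becomes a walk of length 4 by going along an edge
  and back.\<close>

locale saturated_graph = dense_graph +
  assumes walk4: "a \<in> V \<Longrightarrow> b \<in> V \<Longrightarrow> \<not> adj a b \<Longrightarrow> \<exists>x y z. adj a x \<and> adj x y \<and> adj y z \<and> adj z b"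

section \<open>Soundness of the certificates\<close>

definition bounded :: "int \<Rightarrow> table \<Rightarrow> bool" where
  "bounded n g \<longleftrightarrow> (\<forall>i. \<forall>j\<in>set (nbs g i). i < n \<and> j < n)"

definition models :: "(int \<Rightarrow> 'a) \<Rightarrow> table \<Rightarrow> ('a \<Rightarrow> 'a \<Rightarrow> bool) \<Rightarrow> bool" where
  "models r g R \<longleftrightarrow> (\<forall>i. \<forall>j\<in>set (nbs g i). R (r i) (r j))"

lemma nbs_join: "set (nbs (join i j g) k) \<subseteq>
    set (nbs g k) \<union> (if k = i then {j} else {}) \<union> (if k = j then {i} else {})"
  by (induction g) (auto simp: join_def split: if_splits)

lemma bounded_join:
  assumes "bounded n g" "i < n" "j < n"
  shows "bounded n (join i j g)"
  unfolding bounded_def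
proof (intro allI ballI)
  fix k l
  assume "l \<in> set (nbs (join i j g) k)"
  then have "l \<in> set (nbs g k) \<or> k = i \<and> l = j \<or> k = j \<and> l = i"
    using nbs_join[of i j g k] by (auto split: if_splits)
  then show "k < n \<and> l < n"
    using assms unfolding bounded_def by blast
qed

lemma bounded_mono: "bounded n g \<Longrightarrow> n \<le> m \<Longrightarrow> bounded m g"
  unfolding bounded_def by fastforce

lemma bounded_Cons: "bounded n g \<and> v < n \<and> (\<forall>j\<in>set l. j < n) \<Longrightarrow> bounded n ((v, l) # g)"
  unfolding bounded_def by auto

lemma models_join:
  assumes "models r g R" "R (r i) (r j)" "R (r j) (r i)"
  shows "models r (join i j g) R"
  unfolding models_def
proof (intro allI ballI)
  fix k l
  assume "l \<in> set (nbs (join i j g) k)"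
  then have "l \<in> set (nbs g k) \<or> k = i \<and> l = j \<or> k = j \<and> l = i"
    using nbs_join[of i j g k] by (auto split: if_splits)
  then show "R (r k) (r l)"
    using assms unfolding models_def by blast
qed

lemma models_Cons:
  "models r g R \<Longrightarrow> (\<And>j. j \<in> set l \<Longrightarrow> R (r v) (r j)) \<Longrightarrow> models r ((v, l) # g) R"
  unfolding models_def by auto

lemma models_cong:
  "models r g R \<Longrightarrow> bounded n g \<Longrightarrow> (\<And>i. i < n \<Longrightarrow> r i = s i) \<Longrightarrow> models s g R"
  unfolding models_def bounded_def by metis

lemma weight_sum_eq: "weight_sum xs = sum_list (map (\<lambda>(i, w, c). w) xs)"
  by (induction xs rule: weight_sum.induct) auto

lemma prune_eq: "prune c xs = filter (\<lambda>x. fst x \<notin> set c) xs"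
  by (induction xs) auto

context dense_graph
begin

lemma conf_far:
  assumes "models r g adj" "models r f (far adj)" "j \<in> set (conf g f i)"
  shows "far adj (r i) (r j)"
proof -
  consider "j \<in> set (nbs f i)" | "j \<in> set (nbs g i)"
    | a b where "a \<in> set (nbs g i)" "b \<in> set (nbs g a)" "j \<in> set (nbs g b)"
    using assms(3) unfolding conf_def by auto
  then show ?thesis
    by cases (use assms(1,2) adj_far walk3_far in \<open>unfold models_def, blast\<close>)+
qed

lemma light_sound:
  assumes "light xs b"
    and "\<And>i w c. (i, w, c) \<in> set xs \<Longrightarrow> 0 \<le> w \<and> (\<forall>j\<in>set c. far adj (r i) (r j))"
  shows "sum_list (map (\<lambda>(i, w, c). if adj v (r i) then w else 0) xs) \<le> b"
  using assms
proof (induction xs b rule: light.induct)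
  case (1 b)
  then show ?case by simp
next
  case (2 i w c xs b)
  let ?S = "\<lambda>xs. sum_list (map (\<lambda>(i, w, c). if adj v (r i) then w else 0) xs)"
  have w: "0 \<le> w" and far: "\<And>j. j \<in> set c \<Longrightarrow> far adj (r i) (r j)"
    using 2(4)[of i w c] by auto
  have tot: "?S xs \<le> weight_sum xs"
    unfolding weight_sum_eq by (rule sum_list_mono) (use 2(4) in fastforce)
  show ?case
  proof (cases "w + weight_sum xs \<le> b")
    case True
    then show ?thesis using tot w by auto
  next
    case False
    then have l: "light xs b" "light (prune c xs) (b - w)"
      using 2(3) by (auto split: if_splits)
    show ?thesis
    proof (cases "adj v (r i)")
      case True
      \<comment> \<open>The pruned vertices are far from \<open>r i\<close>, hence not adjacent to
        its neighbour \<open>v\<close>; they contribute 0.\<close>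
      have "?S (prune c xs) = ?S xs"
        unfolding prune_eq
      proof (induction xs)
        case (Cons x xs)
        then show ?case
          using far True by (cases x) (fastforce simp: far_def)
      qed simp
      moreover have "?S (prune c xs) \<le> b - w"
        using 2(2)[OF False l(1) l(2)] 2(4) unfolding prune_eq by auto
      ultimately show ?thesis using True by simp
    next
      case f: False
      then show ?thesis using 2(1)[OF False l(1)] 2(4) by auto
    qed
  qed
qed

lemma weigh_sound:
  assumes "check h (Weigh ws) n g f a" "models r g adj" "models r f (far adj)" "range r \<subseteq> V"
  shows False
proof -
  define t where "t = sum_list (map snd ws)"
  define xs where "xs = map (\<lambda>(i, w). (i, w, conf g f i)) ws"
  have t: "weight_sum xs = t"
    unfolding weight_sum_eq xs_def t_def by (induction ws) auto
  have "0 < t" and nonneg: "\<And>i w. (i, w) \<in> set ws \<Longrightarrow> 0 \<le> w" and "light xs (t div 5)"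
    using assms(1) t by (auto simp: Let_def list_all_iff xs_def)
  have le: "5 * (\<Sum>k<length ws. if adj v (r (fst (ws ! k))) then snd (ws ! k) else 0) \<le> t" for v
  proof -
    have "sum_list (map (\<lambda>(i, w, c). if adj v (r i) then w else 0) xs) \<le> t div 5"
      by (rule light_sound[OF \<open>light xs (t div 5)\<close>]) (use nonneg conf_far assms(2,3) in \<open>auto simp: xs_def\<close>)
    moreover have "sum_list (map (\<lambda>(i, w, c). if adj v (r i) then w else 0) xs)
        = sum_list (map (\<lambda>x. if adj v (r (fst x)) then snd x else 0) ws)"
      unfolding xs_def by (induction ws) auto
    ultimately show ?thesis
      by (simp add: sum_list_sum_nth atLeast0LessThan)
  qed
  have "t = (\<Sum>k<length ws. snd (ws ! k))"
    unfolding t_def by (simp add: sum_list_sum_nth atLeast0LessThan)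
  moreover have "0 \<le> snd (ws ! k)" if "k < length ws" for k
    using nonneg[of "fst (ws ! k)" "snd (ws ! k)"] that by (simp add: nth_mem)
  moreover have "(\<lambda>k. r (fst (ws ! k))) ` {..<length ws} \<subseteq> V"
    using assms(4) by blast
  ultimately obtain v where v: "t < 5 * (\<Sum>k<length ws. if adj v (r (fst (ws ! k))) then snd (ws ! k) else 0)"
    using heavy_vertex[of "{..<length ws}" "\<lambda>k. r (fst (ws ! k))" "\<lambda>k. snd (ws ! k)"] \<open>0 < t\<close>
    by auto
  then show False
    using le[of v] by simp
qed

end

context saturated_graph
begin

text \<open>A successful check refutes every interpretation \<open>r\<close> of the names that
  respects the three tables, injective or not. The induction follows the certificate; in each case
  distinction the true alternative yields an interpretation of the tables of one branch.\<close>

theorem check_sound: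
  assumes "check h c n g f a"
    and "bounded n g" "bounded n f" "bounded n a"
    and "models r g adj" "models r f (far adj)" "models r a (\<lambda>x y. \<not> adj x y)"
    and "range r \<subseteq> V" and "h \<Longrightarrow> no_hex adj"
  shows False
  using assms
proof (induction c arbitrary: n g f r)
  case (Weigh ws)
  show ?case
    by (rule weigh_sound) (use Weigh.prems in auto)
next
  case (Clash i j k)
  then have "adj (r i) (r k)" "adj (r j) (r k)" "j \<in> set (conf g f i)"
    by (auto simp: models_def)
  then show ?case
    using conf_far[OF Clash(5,6)] adj_sym unfolding far_def by blast
next
  case (Nonedge i j)
  then have "j \<in> set (nbs g i)" "j \<in> set (nbs a i)"
    by auto
  then show ?case
    using Nonedge(5,7) unfolding models_def by blast
next
  case (Split i j v c d)
  note P = Split.prems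
  have ck: "i < n" "j < n" "n \<le> v"
    "check h c (v + 1) ((v, [i, j]) # join i v (join j v g)) ((v, []) # f) a"
    "check h d n g (join i j f) a"
    using P(1) by auto
  show ?case
  proof (cases "far adj (r i) (r j)")
    case True
    then have "models r (join i j f) (far adj)"
      using P(6) far_commute by (blast intro: models_join)
    then show ?thesis
      using Split.IH(2)[OF ck(5) P(2) bounded_join[OF P(3) ck(1,2)] P(4,5) _ P(7,8)] P(9) by simp
  next
    case False
    then obtain z where z: "adj z (r i)" "adj z (r j)"
      by (auto simp: far_def)
    \<comment> \<open>The tables only mention names below \<open>n\<close>, and
      \<open>n \<le> v\<close>, so redefining \<open>v\<close> does not affect what they
      say.\<close>
    let ?r = "r(v := z)"
    have old: "models ?r g adj" "models ?r f (far adj)" "models ?r a (\<lambda>x y. \<not> adj x y)"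
      by (rule models_cong[OF P(5,2)] models_cong[OF P(6,3)] models_cong[OF P(7,4)]; use ck(3) in auto)+
    show ?thesis
    proof (rule Split.IH(1)[OF ck(4), of ?r])
      show "bounded (v + 1) ((v, [i, j]) # join i v (join j v g))"
        using ck by (intro bounded_Cons bounded_join bounded_mono[OF P(2), of "v + 1"] conjI) auto
      show "bounded (v + 1) ((v, []) # f)"
        using ck by (intro bounded_Cons bounded_mono[OF P(3), of "v + 1"] conjI) auto
      show "bounded (v + 1) a"
        using ck by (intro bounded_mono[OF P(4), of "v + 1"]) auto
      show "models ?r ((v, [i, j]) # join i v (join j v g)) adj"
        using old(1) z adj_sym[OF z(1)] adj_sym[OF z(2)] ck by (intro models_Cons models_join) auto
      show "models ?r ((v, []) # f) (far adj)"
        using old(2) by (intro models_Cons) auto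
      show "range ?r \<subseteq> V"
        using P(8) adj_V[OF z(1)] by auto
    qed (rule old(3), erule P(9))
  qed
next
  case (Edge i j v c d)
  note P = Edge.prems
  have ck: "i < n" "j < n" "n \<le> v" "check h c n (join i j g) f a"
    "check h d (v + 3) ((v, [i, v+1]) # (v+1, [v, v+2]) # (v+2, [v+1, j]) # join i v (join j (v+2) g))
         ((v, []) # (v+1,[]) # (v+2,[]) # f) a"
    using P(1) by auto
  show ?case
  proof (cases "adj (r i) (r j)")
    case True
    then have "models r (join i j g) adj"
      using P(5) adj_sym by (blast intro: models_join)
    then show ?thesis
      using Edge.IH(1)[OF ck(4) bounded_join[OF P(2) ck(1,2)] P(3,4) _ P(6,7,8)] P(9) by simp
  next
    case False
    moreover have "r i \<in> V" "r j \<in> V"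
      using P(8) by auto
    ultimately obtain x y z where z: "adj (r i) x" "adj x y" "adj y z" "adj z (r j)"
      using walk4 by blast
    let ?r = "r(v := x, v + 1 := y, v + 2 := z)"
    have old: "models ?r g adj" "models ?r f (far adj)" "models ?r a (\<lambda>x y. \<not> adj x y)"
      by (rule models_cong[OF P(5,2)] models_cong[OF P(6,3)] models_cong[OF P(7,4)]; use ck(3) in auto)+
    show ?thesis
    proof (rule Edge.IH(2)[OF ck(5), of ?r])
      show "bounded (v + 3) ((v, [i, v+1]) # (v+1, [v, v+2]) # (v+2, [v+1, j]) # join i v (join j (v+2) g))"
        using ck by (intro bounded_Cons bounded_join bounded_mono[OF P(2), of "v + 3"] conjI) auto
      show "bounded (v + 3) ((v, []) # (v+1,[]) # (v+2,[]) # f)"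
        using ck by (intro bounded_Cons bounded_mono[OF P(3), of "v + 3"] conjI) auto
      show "bounded (v + 3) a"
        using ck by (intro bounded_mono[OF P(4), of "v + 3"]) auto
      show "models ?r ((v, [i, v+1]) # (v+1, [v, v+2]) # (v+2, [v+1, j]) # join i v (join j (v+2) g)) adj"
        using old(1) z z[THEN adj_sym] ck by (intro models_Cons models_join) auto
      show "models ?r ((v, []) # (v+1,[]) # (v+2,[]) # f) (far adj)"
        using old(2) by (intro models_Cons) auto
      show "range ?r \<subseteq> V"
        using P(8) z(2-4)[THEN adj_V] by auto
    qed (rule old(3), erule P(9))
  qed
next
  case (Hex i j k l m q c d e)
  note P = Hex.prems
  have mem: "j \<in> set (nbs g i)" "k \<in> set (nbs g j)" "l \<in> set (nbs g k)" "m \<in> set (nbs g l)"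
    "q \<in> set (nbs g m)" "i \<in> set (nbs g q)" and h: h
    and ck: "check h c n (join i l g) f a" "check h d n (join j m g) f a" "check h e n (join k q g) f a"
    using P(1) by auto
  have lt: "i < n" "j < n" "k < n" "l < n" "m < n" "q < n"
    using mem P(2) unfolding bounded_def by blast+
  have "adj (r i) (r j)" "adj (r j) (r k)" "adj (r k) (r l)" "adj (r l) (r m)" "adj (r m) (r q)" "adj (r q) (r i)"
    using mem P(5) unfolding models_def by blast+
  note this = P(9)[OF h, unfolded no_hex_def, rule_format, OF this]
  then consider "adj (r i) (r l)" | "adj (r j) (r m)" | "adj (r k) (r q)"
    by blast
  then show ?case
  proof cases
    case 1
    then show ?thesis
      using Hex.IH(1)[OF ck(1) bounded_join[OF P(2) lt(1,4)] P(3,4) _ P(6,7,8)] P(9)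
        models_join[OF P(5) 1 adj_sym[OF 1]] by simp
  next
    case 2
    then show ?thesis
      using Hex.IH(2)[OF ck(2) bounded_join[OF P(2) lt(2,5)] P(3,4) _ P(6,7,8)] P(9)
        models_join[OF P(5) 2 adj_sym[OF 2]] by simp
  next
    case 3
    then show ?thesis
      using Hex.IH(3)[OF ck(3) bounded_join[OF P(2) lt(3,6)] P(3,4) _ P(6,7,8)] P(9)
        models_join[OF P(5) 3 adj_sym[OF 3]] by simp
  qed
qed

end

section \<open>The certificates\<close>

definition hex_cert :: cert where
  "hex_cert =
     Edge 0 3 6 (Nonedge 0 3) (Edge 2 5 9 (Nonedge 2 5) (Edge 1 4 12 (Nonedge 1 4) (Split 10 13 15
     (Weigh [(1,1),(2,1),(4,1),(5,1),(9,1),(10,1),(11,1),(12,1),(13,1),(14,1)]) (Split 9 14 15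
     (Split 11 12 16 (Weigh [(1,1),(2,1),(4,1),(5,1),(9,1),(10,1),(11,1),(12,1),(13,1),(14,1)])
     (Weigh [(0,1),(1,1),(5,1),(9,1),(10,1),(11,1),(12,1),(13,1),(14,1),(15,1)])) (Split 11 12 15
     (Weigh [(2,1),(3,1),(4,1),(9,1),(10,1),(11,1),(12,1),(13,1),(14,1),(15,1)]) (Split 7 10 15
     (Weigh [(0,1),(2,1),(3,1),(5,1),(6,1),(7,1),(8,1),(9,1),(10,1),(11,1)]) (Split 7 13 15 (Weigh
     [(0,1),(1,1),(3,1),(4,1),(6,1),(7,1),(8,1),(12,1),(13,1),(14,1)]) (Split 6 14 15 (Split 8 12
     16 (Weigh [(0,1),(1,1),(3,1),(4,1),(6,1),(7,1),(8,1),(12,1),(13,1),(14,1)]) (Weigh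
     [(1,1),(2,1),(3,1),(6,1),(7,1),(8,1),(12,1),(13,1),(14,1),(15,1)])) (Split 8 12 15 (Weigh
     [(0,1),(4,1),(5,1),(6,1),(7,1),(8,1),(12,1),(13,1),(14,1),(15,1)]) (Split 8 11 15 (Split 6 9
     16 (Weigh [(0,1),(2,1),(3,1),(5,1),(6,1),(7,1),(8,1),(9,1),(10,1),(11,1)]) (Weigh
     [(0,1),(1,1),(2,1),(6,1),(7,1),(8,1),(9,1),(10,1),(11,1),(14,1)])) (Split 6 9 15 (Weigh
     [(3,1),(4,1),(5,1),(6,1),(7,1),(8,1),(9,1),(10,1),(11,1),(15,1)]) (Weigh
     [(0,1),(1,1),(2,1),(3,1),(4,1),(5,1),(6,1),(7,1),(8,1),(9,1),(10,1),(11,1),(12,1),(13,1),(14,1)]))))))))))))"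

text \<open>The last table declares the long diagonals of the hexagon 0, ..., 5 to be non-edges. The
  flag is \<open>False\<close>, as \<open>no_hex\<close> itself is derived from this check.\<close>

lemma check_hex: "check False hex_cert 6
    [(0, [1, 5]), (1, [0, 2]), (2, [1, 3]), (3, [2, 4]), (4, [3, 5]), (5, [4, 0])]
    [(0, []), (1, []), (2, []), (3, []), (4, []), (5, [])]
    [(0, [3]), (1, [4]), (2, [5]), (3, [0]), (4, [1]), (5, [2])]"
  by code_simp

definition five_cert :: cert where
  "five_cert =
     Weigh [(0,1),(1,1),(2,1),(3,1),(4,1)]"

lemma check_five: "check False five_cert 5
    [(0, []), (1, []), (2, []), (3, []), (4, [])]
    [(0, [1, 2, 3, 4]), (1, [0, 2, 3, 4]), (2, [0, 1, 3, 4]), (3, [0, 1, 2, 4]), (4, [0, 1, 2, 3])]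
    [(0, []), (1, []), (2, []), (3, []), (4, [])]"
  by code_simp

text \<open>In this and the next three certificates 0, ..., 6 is a 7-cycle, 7 a vertex without
  neighbours on it, and 8 and 9 are neighbours of 7 that have neighbours on the cycle. The names
  list positions on the cycle that share a neighbour with 7.\<close>

definition only_0_cert :: cert where
  "only_0_cert =
     Edge 3 7 9 (Nonedge 3 7) (Edge 1 7 12 (Nonedge 1 7) (Edge 6 7 15 (Nonedge 6 7) (Split 2 14 18
     (Split 5 14 22 (Split 3 8 23 (Weigh
     [(0,1),(2,1),(3,1),(4,1),(5,1),(6,1),(7,1),(8,1),(14,1),(18,1)]) (Weigh
     [(0,1),(1,1),(2,1),(3,1),(4,1),(5,1),(7,1),(8,1),(14,1),(22,1)])) (Split 2 17 24 (Split 3 15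
     28 (Split 8 28 29 (Weigh [(0,1),(1,1),(2,1),(3,1),(7,1),(8,1),(15,1),(16,1),(17,1),(28,1)])
     (Weigh [(0,1),(2,1),(3,1),(6,1),(7,1),(8,1),(15,1),(17,1),(24,1),(28,1)])) (Split 5 17 30
     (Split 4 8 31 (Weigh [(0,1),(1,1),(2,1),(3,1),(4,1),(5,1),(7,1),(8,1),(17,1),(30,1)]) (Weigh
     [(0,1),(2,1),(3,1),(4,1),(5,1),(6,1),(7,1),(8,1),(17,1),(24,1)])) (Split 4 17 33 (Split 3 8
     35 (Split 16 35 36 (Weigh
     [(0,1),(2,1),(3,1),(4,1),(5,1),(6,2),(7,1),(8,1),(15,1),(16,1),(17,1),(33,1),(35,1),(36,1)])
     (Weigh [(3,1),(4,1),(5,1),(6,1),(7,1),(8,1),(15,1),(16,1),(17,1),(35,1)])) (Split 4 8 35 (Hex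
     0 6 5 4 35 8 (Clash 2 0 1) (Hex 4 33 17 7 8 35 (Nonedge 4 7) (Hex 0 6 5 4 33 8 (Clash 2 0 1)
     (Clash 16 6 15) (Clash 7 5 8)) (Clash 16 6 15)) (Clash 7 5 8)) (Weigh
     [(3,1),(4,1),(7,1),(8,1),(15,1)]))) (Weigh [(1,1),(4,1),(5,1),(7,1),(17,1)])))) (Split 3 17
     24 (Split 5 17 26 (Split 6 18 27 (Hex 3 4 5 26 17 24 (Weigh
     [(0,1),(2,1),(3,1),(5,1),(6,1),(7,1),(8,1),(14,1),(18,1),(26,1)]) (Clash 7 4 17) (Weigh
     [(0,1),(2,1),(3,1),(5,1),(6,1),(7,1),(8,1),(14,1),(18,1),(24,1)])) (Split 0 24 27 (Hex 3 4 5
     26 17 24 (Weigh [(0,1),(1,1),(2,1),(5,1),(6,1),(7,1),(14,1),(17,1),(18,1),(26,1)]) (Clash 7 4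
     17) (Clash 5 0 6)) (Weigh
     [(0,1),(1,1),(2,1),(5,1),(6,1),(7,1),(14,1),(17,1),(18,1),(24,1)]))) (Weigh
     [(2,1),(5,1),(6,1),(7,1),(17,1)])) (Weigh [(2,1),(3,1),(6,1),(7,1),(17,1)])))) (Split 5 14 18
     (Split 3 14 19 (Split 4 12 21 (Split 7 21 22 (Weigh
     [(0,1),(1,1),(4,1),(5,1),(7,1),(8,1),(12,1),(14,1),(18,1),(21,1)]) (Weigh
     [(2,1),(6,1),(7,1),(14,1),(21,1)])) (Split 5 12 22 (Split 4 11 23 (Split 1 11 24 (Split 13 23
     25 (Weigh
     [(1,2),(2,1),(3,1),(4,1),(5,1),(7,1),(11,1),(12,1),(13,1),(14,1),(19,1),(23,1),(24,1),(25,1)])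
     (Weigh [(1,1),(2,1),(3,1),(4,1),(7,1),(11,1),(12,1),(13,1),(14,1),(23,1)])) (Split 2 11 24
     (Split 12 23 26 (Weigh
     [(0,1),(1,2),(2,2),(3,1),(4,1),(5,1),(7,2),(8,1),(11,1),(12,1),(13,1),(14,2),(19,1),(23,1),(24,1),(26,1)])
     (Split 6 11 26 (Hex 3 4 5 18 14 19 (Weigh
     [(0,1),(1,1),(2,1),(5,1),(6,1),(7,1),(11,1),(14,1),(18,1),(24,1)]) (Clash 7 4 14) (Weigh
     [(0,1),(1,1),(2,1),(5,1),(6,1),(7,1),(11,1),(14,1),(19,1),(24,1)])) (Split 0 19 26 (Weigh
     [(0,1),(1,1),(2,1),(3,1),(4,1),(5,1),(6,1),(7,1),(8,1),(11,1),(12,1),(13,1),(14,1),(19,1),(23,1)])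
     (Weigh
     [(0,1),(1,1),(2,1),(3,1),(4,1),(5,1),(6,1),(7,2),(8,1),(11,1),(12,1),(14,1),(19,1),(24,1)]))))
     (Weigh [(1,1),(2,1),(5,1),(7,1),(11,1)]))) (Split 11 12 23 (Split 2 11 24 (Split 3 8 25
     (Split 5 11 26 (Weigh [(0,1),(2,1),(3,1),(4,1),(5,1),(6,1),(7,1),(8,1),(11,1),(24,1)]) (Weigh
     [(1,1),(4,1),(5,1),(7,1),(11,1)])) (Weigh
     [(0,1),(1,1),(2,1),(3,1),(4,1),(5,1),(7,1),(8,1),(11,1),(13,1)])) (Split 6 11 24 (Weigh
     [(0,2),(1,3),(2,3),(3,2),(4,3),(5,3),(6,1),(7,3),(8,1),(11,4),(12,1),(13,1),(14,1),(22,1),(23,1),(24,1)])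
     (Weigh [(2,1),(3,1),(6,1),(7,1),(11,1)]))) (Weigh [(3,1),(4,1),(7,1),(11,1),(12,1)]))) (Weigh
     [(1,1),(4,1),(5,1),(7,1),(12,1)]))) (Weigh [(2,1),(3,1),(6,1),(7,1),(14,1)])) (Weigh
     [(1,1),(2,1),(5,1),(7,1),(14,1)])))))"

lemma check_only_0: "check True only_0_cert 9
    [(0, [1, 6, 8]), (1, [0, 2]), (2, [1, 3]), (3, [2, 4]), (4, [3, 5]), (5, [4, 6]), (6, [5, 0]), (7, [8]), (8, [7, 0])]
    [(0, []), (1, [7]), (2, [7]), (3, [7]), (4, [7]), (5, [7]), (6, [7]), (7, [1, 2, 3, 4, 5, 6]), (8, [])]
    [(0, [7]), (1, [7]), (2, [7]), (3, [7]), (4, [7]), (5, [7]), (6, [7]), (7, [0, 1, 2, 3, 4, 5, 6]), (8, [])]"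
  by code_simp

definition pair_0_2_cert :: cert where
  "pair_0_2_cert =
     Edge 1 7 9 (Nonedge 1 7) (Edge 6 7 12 (Nonedge 6 7) (Edge 3 7 15 (Nonedge 3 7) (Split 3 13 18
     (Split 5 14 19 (Weigh [(0,1),(3,1),(4,1),(5,1),(6,1),(7,1),(8,1),(13,1),(14,1),(18,1)])
     (Weigh [(2,1),(3,1),(4,1),(5,1),(6,1),(7,1),(8,1),(12,1),(13,1),(14,1)])) (Split 6 16 18
     (Split 4 17 19 (Weigh [(2,1),(3,1),(4,1),(5,1),(6,1),(7,1),(8,1),(16,1),(17,1),(18,1)])
     (Weigh [(0,1),(3,1),(4,1),(5,1),(6,1),(7,1),(8,1),(15,1),(16,1),(17,1)])) (Split 5 17 18
     (Split 0 15 19 (Weigh [(0,1),(3,1),(4,1),(5,1),(6,1),(7,1),(8,1),(15,1),(16,1),(17,1)])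
     (Weigh [(0,1),(2,1),(3,1),(5,1),(6,1),(8,1),(15,1),(16,1),(17,1),(18,1)])) (Split 4 14 18
     (Split 2 12 19 (Weigh [(2,1),(3,1),(4,1),(5,1),(6,1),(7,1),(8,1),(12,1),(13,1),(14,1)])
     (Weigh [(0,1),(2,1),(3,1),(4,1),(6,1),(8,1),(12,1),(13,1),(14,1),(18,1)])) (Split 4 9 18
     (Split 5 14 20 (Split 3 14 21 (Split 9 14 22 (Hex 2 3 21 14 7 8 (Clash 9 2 1) (Nonedge 3 7)
     (Weigh [(0,1),(4,1),(5,1),(6,1),(8,1),(9,1),(14,1),(18,1),(21,1),(22,1)])) (Split 5 11 22
     (Hex 1 2 3 4 18 9 (Clash 4 0 1) (Weigh
     [(0,1),(4,1),(5,1),(6,1),(7,1),(8,1),(9,1),(10,1),(11,1),(18,1)]) (Weigh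
     [(0,1),(3,1),(4,1),(5,1),(6,1),(7,1),(8,1),(9,1),(10,1),(11,1)])) (Split 4 11 23 (Split 1 20
     24 (Weigh
     [(1,1),(2,1),(3,1),(4,1),(5,1),(6,1),(7,2),(8,1),(9,1),(11,1),(14,1),(20,1),(23,1),(24,1)])
     (Hex 4 18 9 10 11 23 (Weigh
     [(0,1),(1,1),(5,1),(6,1),(7,1),(9,1),(10,1),(11,1),(14,1),(20,1)]) (Weigh
     [(0,1),(1,1),(5,1),(6,1),(7,1),(9,1),(11,1),(14,1),(18,1),(20,1)]) (Weigh
     [(0,1),(1,1),(5,1),(6,1),(7,1),(9,1),(11,1),(14,1),(20,1),(23,1)]))) (Weigh
     [(1,1),(4,1),(5,1),(7,1),(11,1)])))) (Split 9 14 21 (Weigh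
     [(0,1),(3,1),(4,1),(5,1),(6,1),(7,1),(8,1),(9,1),(14,1),(21,1)]) (Weigh
     [(3,1),(6,1),(7,1),(9,1),(14,1)]))) (Split 9 14 20 (Weigh [(1,1),(4,1),(5,1),(7,1),(14,1)])
     (Weigh [(5,1),(6,1),(7,1),(9,1),(14,1)]))) (Split 5 9 18 (Split 4 17 20 (Split 6 17 21 (Split
     9 17 22 (Hex 0 6 21 17 7 8 (Clash 9 0 1) (Nonedge 6 7) (Weigh
     [(2,1),(3,1),(4,1),(5,1),(8,1),(9,1),(17,1),(18,1),(21,1),(22,1)])) (Split 7 18 22 (Hex 4 5 6
     21 17 20 (Weigh [(1,1),(2,1),(3,1),(4,1),(7,1),(9,1),(17,1),(18,1),(21,1),(22,1)]) (Clash 7 5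
     17) (Weigh [(1,1),(2,1),(3,1),(4,1),(7,1),(9,1),(17,1),(18,1),(20,1),(22,1)])) (Split 17 18
     22 (Split 4 11 23 (Weigh [(2,1),(3,1),(4,1),(5,1),(7,1),(8,1),(9,1),(10,1),(11,1),(18,1)])
     (Split 3 10 24 (Weigh [(0,1),(3,1),(4,1),(5,1),(7,1),(8,1),(10,1),(11,1),(18,1),(24,1)]) (Hex
     4 5 18 22 17 20 (Weigh [(1,1),(2,1),(3,1),(4,1),(7,1),(9,1),(10,1),(11,1),(17,1),(22,1)])
     (Clash 7 5 17) (Weigh [(1,1),(2,1),(3,1),(4,1),(7,1),(9,1),(10,1),(11,1),(17,1),(20,1)]))))
     (Weigh [(3,1),(7,1),(9,1),(17,1),(18,1)])))) (Split 9 17 21 (Weigh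
     [(2,1),(3,1),(4,1),(5,1),(6,1),(7,1),(8,1),(9,1),(17,1),(21,1)]) (Weigh
     [(3,1),(6,1),(7,1),(9,1),(17,1)]))) (Split 9 17 20 (Weigh [(1,1),(4,1),(5,1),(7,1),(17,1)])
     (Weigh [(3,1),(4,1),(7,1),(9,1),(17,1)]))) (Weigh [(1,1),(4,1),(5,1),(7,1),(9,1)])))))))))"

lemma check_pair_0_2: "check True pair_0_2_cert 9
    [(0, [1, 6, 8]), (1, [0, 2]), (2, [1, 3, 8]), (3, [2, 4]), (4, [3, 5]), (5, [4, 6]), (6, [5, 0]), (7, [8]), (8, [7, 0, 2])]
    [(0, []), (1, []), (2, []), (3, []), (4, [7]), (5, [7]), (6, []), (7, [4, 5]), (8, [])]
    [(0, [7]), (1, [7]), (2, [7]), (3, [7]), (4, [7]), (5, [7]), (6, [7]), (7, [0, 1, 2, 3, 4, 5, 6]), (8, [])]"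
  by code_simp

definition triple_5_0_2_cert :: cert where
  "triple_5_0_2_cert =
     Edge 1 7 10 (Nonedge 1 7) (Edge 6 7 13 (Nonedge 6 7) (Split 3 14 16 (Weigh
     [(2,1),(3,1),(4,1),(5,1),(6,1),(7,1),(8,1),(13,1),(14,1),(15,1)]) (Split 4 11 16 (Weigh
     [(1,1),(2,1),(3,1),(4,1),(5,1),(7,1),(9,1),(10,1),(11,1),(12,1)]) (Split 4 15 16 (Split 2 13
     17 (Weigh [(2,1),(3,1),(4,1),(5,1),(6,1),(7,1),(8,1),(13,1),(14,1),(15,1)]) (Weigh
     [(0,1),(2,1),(3,1),(4,1),(6,1),(8,1),(13,1),(14,1),(15,1),(16,1)])) (Split 2 13 16 (Weigh
     [(2,1),(3,1),(4,1),(5,1),(7,1),(9,1),(13,1),(14,1),(15,1),(16,1)]) (Split 5 11 16 (Split 3 12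
     17 (Weigh [(0,1),(1,1),(3,1),(4,1),(5,1),(9,1),(10,1),(11,1),(12,1),(17,1)]) (Split 10 14 17
     (Split 12 13 18 (Weigh
     [(0,2),(1,1),(3,1),(5,1),(6,2),(7,2),(8,1),(9,1),(10,3),(11,2),(12,2),(13,2),(14,2),(15,1),(17,1),(18,1)])
     (Weigh [(0,1),(1,1),(6,1),(7,1),(10,1),(11,1),(12,1),(13,1),(14,1),(15,1)])) (Split 12 13 17
     (Split 3 17 18 (Weigh
     [(0,1),(2,1),(3,2),(4,1),(5,1),(6,1),(7,1),(8,1),(9,1),(10,1),(12,1),(13,1),(14,1),(17,1)])
     (Split 4 17 18 (Hex 5 9 7 12 11 16 (Clash 12 4 5) (Clash 9 1 0) (Weigh
     [(0,1),(1,1),(2,1),(3,1),(4,1),(5,1),(6,1),(7,1),(8,1),(10,1),(11,1),(12,1),(13,1),(14,1),(16,1)]))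
     (Weigh [(0,1),(2,1),(3,1),(4,1),(6,1),(8,1),(11,1),(12,1),(13,1),(17,1)]))) (Split 11 13 18
     (Split 1 15 19 (Weigh [(0,1),(1,1),(6,1),(7,1),(10,1),(11,1),(12,1),(13,1),(14,1),(15,1)])
     (Weigh [(0,1),(1,1),(4,1),(7,1),(8,1),(10,1),(11,1),(13,1),(14,1),(15,1)])) (Split 1 15 18
     (Weigh [(1,1),(2,1),(5,1),(6,1),(10,1),(11,1),(12,1),(13,1),(14,1),(15,1)]) (Weigh
     [(0,1),(1,1),(2,1),(3,1),(4,1),(5,1),(6,1),(7,1),(8,1),(10,1),(11,1),(12,1),(13,1),(14,1),(15,1)]))))))
     (Split 6 11 16 (Split 3 12 20 (Split 4 10 21 (Weigh
     [(0,1),(1,1),(2,1),(3,1),(4,2),(5,2),(6,1),(7,1),(8,1),(9,1),(10,1),(11,2),(12,2),(16,1),(20,1),(21,1)])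
     (Weigh [(1,1),(2,1),(3,1),(4,1),(5,1),(7,1),(9,1),(10,1),(11,1),(12,1)])) (Hex 0 1 10 11 16 6
     (Clash 7 0 8) (Weigh [(2,1),(3,1),(4,1),(5,1),(6,1),(7,1),(8,1),(11,1),(12,1),(16,1)]) (Weigh
     [(2,1),(3,1),(4,1),(5,1),(6,1),(7,1),(8,1),(10,1),(11,1),(12,1)]))) (Weigh
     [(2,1),(5,1),(6,1),(11,1),(15,1)]))))))))"

lemma check_triple_5_0_2: "check True triple_5_0_2_cert 10
    [(0, [1, 6, 8, 9]), (1, [0, 2]), (2, [1, 3, 8]), (3, [2, 4]), (4, [3, 5]), (5, [4, 6, 9]), (6, [5, 0]), (7, [8, 9]), (8, [7, 0, 2]), (9, [7, 0, 5])]
    [(0, []), (1, []), (2, []), (3, []), (4, []), (5, []), (6, []), (7, []), (8, []), (9, [])]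
    [(0, [7]), (1, [7]), (2, [7]), (3, [7]), (4, [7]), (5, [7]), (6, [7]), (7, [0, 1, 2, 3, 4, 5, 6]), (8, []), (9, [])]"
  by code_simp

definition pair_0_3_cert :: cert where
  "pair_0_3_cert =
     Edge 4 7 10 (Nonedge 4 7) (Edge 6 7 13 (Nonedge 6 7) (Split 2 12 16 (Split 5 12 17 (Weigh
     [(0,1),(1,1),(2,1),(3,1),(4,1),(5,1),(7,1),(8,1),(12,1),(17,1)]) (Weigh
     [(1,1),(4,1),(5,1),(7,1),(12,1)])) (Split 5 12 16 (Split 1 16 17 (Weigh
     [(0,1),(1,1),(2,1),(3,1),(4,1),(5,1),(7,1),(8,1),(12,1),(16,1)]) (Weigh
     [(0,1),(1,1),(2,1),(3,1),(5,1),(6,1),(7,1),(9,1),(12,1),(16,1)])) (Split 6 12 16 (Split 4 15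
     17 (Split 11 13 18 (Weigh
     [(4,1),(5,1),(6,1),(7,1),(10,1),(11,1),(12,1),(13,1),(14,1),(15,1)]) (Split 10 14 18 (Weigh
     [(4,1),(5,1),(6,1),(7,1),(10,1),(11,1),(12,1),(13,1),(14,1),(15,1)]) (Weigh
     [(4,1),(6,1),(10,1),(11,1),(12,1),(13,1),(14,1),(15,1),(16,1),(17,1)]))) (Split 1 15 19
     (Split 5 15 20 (Weigh [(0,1),(1,1),(2,1),(3,1),(5,1),(6,1),(7,1),(9,1),(15,1),(20,1)]) (Weigh
     [(2,1),(5,1),(6,1),(7,1),(15,1)])) (Split 5 15 19 (Split 2 19 20 (Weigh
     [(0,1),(1,1),(2,1),(3,1),(5,1),(6,1),(7,1),(9,1),(15,1),(19,1)]) (Weigh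
     [(0,1),(1,1),(2,1),(3,1),(4,1),(5,1),(7,1),(8,1),(15,1),(19,1)])) (Weigh
     [(1,1),(4,1),(5,1),(7,1),(15,1)])))) (Weigh [(2,1),(5,1),(6,1),(7,1),(12,1)])))))"

lemma check_pair_0_3: "check True pair_0_3_cert 10
    [(0, [1, 6, 8]), (1, [0, 2]), (2, [1, 3]), (3, [2, 4, 9]), (4, [3, 5]), (5, [4, 6]), (6, [5, 0]), (7, [8, 9]), (8, [7, 0]), (9, [7, 3])]
    [(0, []), (1, []), (2, []), (3, []), (4, []), (5, [7]), (6, []), (7, [5]), (8, []), (9, [])]
    [(0, [7]), (1, [7]), (2, [7]), (3, [7]), (4, [7]), (5, [7]), (6, [7]), (7, [0, 1, 2, 3, 4, 5, 6]), (8, []), (9, [])]"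
  by code_simp


lemma bounded_table: "\<forall>(k, l)\<in>set g. \<forall>j\<in>set l. k < n \<and> j < n \<Longrightarrow> bounded n g"
  unfolding bounded_def by (induction g) (auto split: prod.splits)

lemma models_table: "\<forall>(k, l)\<in>set g. \<forall>j\<in>set l. R (r k) (r j) \<Longrightarrow> models r g R"
  unfolding models_def by (induction g) (auto split: prod.splits)

subsection \<open>Hexagons and 7-cycles\<close>

context saturated_graph
begin

lemma no_hex: "no_hex adj"
  unfolding no_hex_def
proof (intro allI impI)
  fix a b c d e f
  assume adj: "adj a b" "adj b c" "adj c d" "adj d e" "adj e f" "adj f a"
  note adj' = adj[THEN adj_sym]
  show "adj a d \<or> adj b e \<or> adj c f"
  proof (rule ccontr)
    assume "\<not> ?thesis"
    then have non: "\<not> adj a d" "\<not> adj b e" "\<not> adj c f" "\<not> adj d a" "\<not> adj e b" "\<not> adj f c"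
      using adj_sym by blast+
    \<comment> \<open>Names outside 0, ..., 5 get the default \<open>a\<close>, because the whole
      range of the interpretation must lie in \<open>V\<close>.\<close>
    let ?r = "(\<lambda>_. a)(1 := b, 2 := c, 3 := d, 4 := e, 5 := f) :: int \<Rightarrow> 'a"
    show False
    proof (rule check_sound[OF check_hex, where r = ?r])
      show "range ?r \<subseteq> V"
        using adj[THEN adj_V] by auto
    qed ((rule bounded_table models_table, simp add: adj adj' non)+, simp)
  qed
qed

text \<open>The neighbourhoods would be five disjoint sets, each with more than a fifth of the
  vertices.\<close>

lemma five_far:
  assumes V: "a \<in> V" "b \<in> V" "c \<in> V" "d \<in> V" "e \<in> V"
    and far: "far adj a b" "far adj a c" "far adj a d" "far adj a e" "far adj b c"
      "far adj b d" "far adj b e" "far adj c d" "far adj c e" "far adj d e"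
  shows False
proof -
  let ?r = "(\<lambda>_. a)(1 := b, 2 := c, 3 := d, 4 := e) :: int \<Rightarrow> 'a"
  have far': "far adj b a" "far adj c a" "far adj d a" "far adj e a" "far adj c b"
      "far adj d b" "far adj e b" "far adj d c" "far adj e c" "far adj e d"
    using far by (simp_all only: far_commute)
  show False
  proof (rule check_sound[OF check_five, where r = ?r])
    show "range ?r \<subseteq> V"
      using V by auto
  qed ((rule bounded_table models_table, simp add: far far')+, simp)
qed

text \<open>A periodic sequence, so that rotating the cycle is a shift of the index. The seven
  vertices are distinct: a repetition would split off a closed walk of length 1, 3 or 5.\<close>

definition seven_cycle :: "(nat \<Rightarrow> 'a) \<Rightarrow> bool" where
  "seven_cycle x \<longleftrightarrow> (\<forall>i. adj (x i) (x (Suc i)) \<and> x (i + 7) = x i)"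

lemma seven_cycle_shift: "seven_cycle x \<Longrightarrow> seven_cycle (\<lambda>i. x (i + k))"
  unfolding seven_cycle_def by (metis add.commute add.left_commute add_Suc)

lemma seven_cycle_adj:
  assumes "seven_cycle x"
  shows "adj (x 0) (x 1)" "adj (x 1) (x 2)" "adj (x 2) (x 3)" "adj (x 3) (x 4)"
    "adj (x 4) (x 5)" "adj (x 5) (x 6)" "adj (x 6) (x 0)"
proof -
  have *: "adj (x i) (x (Suc i))" and p: "x (i + 7) = x i" for i
    using assms unfolding seven_cycle_def by blast+
  show "adj (x 0) (x 1)" "adj (x 1) (x 2)" "adj (x 2) (x 3)" "adj (x 3) (x 4)"
    "adj (x 4) (x 5)" "adj (x 5) (x 6)" "adj (x 6) (x 0)"
    using *[of 0] *[of 1] *[of 2] *[of 3] *[of 4] *[of 5] *[of 6] p[of 0] by (simp_all add: numeral_eq_Suc)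
qed

lemma seven_cycle_V: "seven_cycle x \<Longrightarrow> x i \<in> V"
  unfolding seven_cycle_def using adj_V by blast

context
  fixes x :: "nat \<Rightarrow> 'a" and p :: 'a
  assumes x: "seven_cycle x" and p: "\<And>i. \<not> adj p (x i)"
begin

lemma non_adj: "\<not> adj (x i) p"
  using p adj_sym by blast

lemmas cycle_adj = seven_cycle_adj[OF x] seven_cycle_adj[OF x, THEN adj_sym]

lemma not_only_0:
  assumes q: "adj q p" "adj q (x 0)"
    and far: "far adj p (x 1)" "far adj p (x 2)" "far adj p (x 3)" "far adj p (x 4)" "far adj p (x 5)" "far adj p (x 6)"
  shows False
proof -
  let ?r = "(\<lambda>i. x (nat i))(7 := p, 8 := q)"
  note far' = far[unfolded far_commute[of p]]
  show False
  proof (rule check_sound[OF check_only_0, where r = ?r])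
    show "range ?r \<subseteq> V"
      using seven_cycle_V[OF x] q[THEN adj_V] q(1)[THEN adj_sym, THEN adj_V] by auto
  qed ((rule bounded_table models_table, simp add: cycle_adj q q[THEN adj_sym] far far' p non_adj One_nat_def[symmetric] del: One_nat_def)+, rule no_hex)
qed

lemma not_0_2:
  assumes q: "adj q p" "adj q (x 0)" "adj q (x 2)"
    and far: "far adj p (x 4)" "far adj p (x 5)"
  shows False
proof -
  let ?r = "(\<lambda>i. x (nat i))(7 := p, 8 := q)"
  note far' = far[unfolded far_commute[of p]]
  show False
  proof (rule check_sound[OF check_pair_0_2, where r = ?r])
    show "range ?r \<subseteq> V"
      using seven_cycle_V[OF x] q[THEN adj_V] q(1)[THEN adj_sym, THEN adj_V] by auto
  qed ((rule bounded_table models_table, simp add: cycle_adj q q[THEN adj_sym] far far' p non_adj One_nat_def[symmetric] del: One_nat_def)+, rule no_hex)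
qed

lemma not_5_0_2:
  assumes q: "adj q p" "adj q (x 0)" "adj q (x 2)" and s: "adj s p" "adj s (x 0)" "adj s (x 5)"
  shows False
proof -
  let ?r = "(\<lambda>i. x (nat i))(7 := p, 8 := q, 9 := s)"
  show False
  proof (rule check_sound[OF check_triple_5_0_2, where r = ?r])
    show "range ?r \<subseteq> V"
      using seven_cycle_V[OF x] q[THEN adj_V] s[THEN adj_V] q(1)[THEN adj_sym, THEN adj_V] by auto
  qed ((rule bounded_table models_table,
        simp add: cycle_adj q q[THEN adj_sym] s s[THEN adj_sym] p non_adj One_nat_def[symmetric] del: One_nat_def)+, rule no_hex)
qed

lemma not_0_3:
  assumes q: "adj q p" "adj q (x 0)" and s: "adj s p" "adj s (x 3)" and far: "far adj p (x 5)"
  shows False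
proof -
  let ?r = "(\<lambda>i. x (nat i))(7 := p, 8 := q, 9 := s)"
  note far' = far[unfolded far_commute[of p]]
  show False
  proof (rule check_sound[OF check_pair_0_3, where r = ?r])
    show "range ?r \<subseteq> V"
      using seven_cycle_V[OF x] q[THEN adj_V] s[THEN adj_V] q(1)[THEN adj_sym, THEN adj_V] by auto
  qed ((rule bounded_table models_table,
        simp add: cycle_adj q q[THEN adj_sym] s s[THEN adj_sym] far far' p non_adj One_nat_def[symmetric] del: One_nat_def)+, rule no_hex)
qed

text \<open>The hexagon through two common neighbours merges them into one.\<close>

lemma merge:
  assumes "\<not> far adj p (x i)" "\<not> far adj p (x (i + 2))"
  obtains q where "adj q p" "adj q (x i)" "adj q (x (i + 2))"
proof -
  obtain s t where s: "adj s p" "adj s (x i)" and t: "adj t p" "adj t (x (i + 2))"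
    using assms unfolding far_def by blast
  have c: "adj (x i) (x (i + 1))" "adj (x (i + 1)) (x (i + 2))"
    using x unfolding seven_cycle_def by (metis Suc_eq_plus1 add_2_eq_Suc')+
  have "adj p (x (i + 1)) \<or> adj s (x (i + 2)) \<or> adj (x i) t"
    using no_hex s(1)[THEN adj_sym] s(2) c t(2)[THEN adj_sym] t(1) unfolding no_hex_def by blast
  then show thesis
    using that s t p adj_sym by blast
qed

lemma far_or_far_Suc: "far adj p (x i) \<or> far adj p (x (Suc i))"
proof (rule ccontr)
  assume "\<not> ?thesis"
  then obtain s t where "adj s p" "adj s (x i)" "adj t p" "adj t (x (Suc i))"
    unfolding far_def by blast
  moreover have "adj (x i) (x (Suc i))"
    using x unfolding seven_cycle_def by blast
  ultimately show False
    using no_pentagon[of p s "x i" "x (Suc i)" t] adj_sym by blast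
qed

end

text \<open>The positions that share a neighbour with \<open>p\<close> form a subset of the integers
  modulo 7. The certificates, applied to all rotations, exclude every nonempty subset.\<close>

lemma far_from_cycle:
  assumes x: "seven_cycle x" and p: "\<And>i. \<not> adj p (x i)"
  shows "far adj p (x i)"
proof (rule ccontr)
  assume *: "\<not> far adj p (x i)"
  define P where "P k = (\<not> far adj p (x (i + k)))" for k
  have per: "P (k + 7) = P k" for k
    using x unfolding P_def seven_cycle_def by (metis add.assoc)
  have cyc: "seven_cycle (\<lambda>j. x (j + k))" for k
    by (rule seven_cycle_shift[OF x])
  have Suc: "\<not> (P k \<and> P (Suc k))" for k
    using far_or_far_Suc[OF x p] unfolding P_def by (metis add_Suc_right)
  have m3: "\<not> (P k \<and> P (k + 2) \<and> P (k + 4))" for k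
  proof (intro notI, elim conjE)
    assume P: "P k" "P (k + 2)" "P (k + 4)"
    obtain q where q: "adj q p" "adj q (x (i + k))" "adj q (x (i + k + 2))"
      using merge[OF x p, of "i + k"] P unfolding P_def by (metis add.assoc)
    obtain s where s: "adj s p" "adj s (x (i + k + 2))" "adj s (x (i + k + 2 + 2))"
      using merge[OF x p, of "i + k + 2"] P unfolding P_def
      by (metis (no_types, lifting) add.assoc numeral_Bit0)
    have "x (i + (k + 7)) = x (i + k)"
      using x unfolding seven_cycle_def by (metis add.assoc)
    \<comment> \<open>Counted from \<open>i + k + 2\<close>, the three positions are 5, 0 and 2,
      since \<open>k\<close> and \<open>k + 7\<close> are the same position.\<close>
    then show False
      by (intro not_5_0_2[OF cyc[of "i + k + 2"] p, of s q]) (use q s in \<open>auto simp: algebra_simps\<close>)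
  qed
  have m4: "\<not> (P k \<and> P (k + 3) \<and> \<not> P (k + 5))" for k
    using not_0_3[OF cyc[of "i + k"] p] unfolding P_def far_def by (fastforce simp: algebra_simps)
  have m2: "\<not> (P k \<and> P (k + 2) \<and> \<not> P (k + 4) \<and> \<not> P (k + 5))" for k
  proof (intro notI, elim conjE)
    assume P: "P k" "P (k + 2)" "\<not> P (k + 4)" "\<not> P (k + 5)"
    obtain q where q: "adj q p" "adj q (x (i + k))" "adj q (x (i + k + 2))"
      using merge[OF x p, of "i + k"] P unfolding P_def by (metis add.assoc)
    show False
      by (rule not_0_2[OF cyc[of "i + k"] p, of q])
        (use q P in \<open>auto simp: P_def algebra_simps\<close>)
  qed
  have m1: "\<not> (P k \<and> \<not> P (k + 1) \<and> \<not> P (k + 2) \<and> \<not> P (k + 3) \<and> \<not> P (k + 4) \<and> \<not> P (k + 5) \<and> \<not> P (k + 6))" for k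
    using not_only_0[OF cyc[of "i + k"] p] unfolding P_def far_def[of _ _ "x (i + k)"]
    by (auto simp: algebra_simps)
  \<comment> \<open>Modulo 7, position 0 excludes 1 and 6. Position 2 would require 4 or 5, both
    refuted by \<open>m3\<close>; 5 would require 2 or 3, and 3 is refuted by \<open>m3\<close>;
    then 3 would require 5, and 4 would require 2. Finally \<open>m1\<close> refutes 0
    alone.\<close>
  have P0: "P 0"
    using * by (simp add: P_def)
  have P7: "P 7 = P 0" "P 9 = P 2" "P 10 = P 3"
    using per[of 0] per[of 2] per[of 3] by simp_all
  have "\<not> P 1" "\<not> P 6"
    using P0 P7 Suc[of 0] Suc[of 6] by (auto simp: numeral_2_eq_2)
  moreover have "P 2 \<or> P 3 \<or> P 4 \<or> P 5"
    using P0 m1[of 0] calculation by (auto simp: numeral_2_eq_2)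
  moreover have "\<not> P 2"
    using P0 P7 m2[of 0] m3[of 0] m3[of 5] by (auto simp: numeral_2_eq_2)
  moreover have "\<not> P 5"
    using P0 P7 m2[of 5] m3[of 3] calculation by (auto simp: numeral_2_eq_2)
  moreover have "\<not> P 3" "\<not> P 4"
    using P0 P7 m4[of 0] m4[of 4] calculation by (auto simp: numeral_2_eq_2)
  ultimately show False
    by blast
qed

text \<open>A vertex \<open>p\<close> without neighbours on the cycle is far from all of it. So a
  neighbour \<open>w\<close> of \<open>p\<close> has none there either and is far from it too, and
  \<open>w\<close>, \<open>p\<close>, \<open>x 0\<close>, \<open>x 1\<close>, \<open>x 4\<close> are
  pairwise far.\<close>

theorem seven_cycle_dominates:
  assumes x: "seven_cycle x" and "p \<in> V"
  shows "\<exists>i. adj p (x i)"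
proof (rule ccontr)
  assume "\<not> ?thesis"
  then have p: "\<And>i. \<not> adj p (x i)"
    by blast
  note far = far_from_cycle[OF x p]
  have "{u. adj u p} \<noteq> {}"
    using degree[OF \<open>p \<in> V\<close>] by (metis card.empty mult_0_right not_less0)
  then obtain w where w: "adj w p"
    by blast
  have "\<not> adj w (x i)" for i
    using far[of i] w unfolding far_def by blast
  note far' = far_from_cycle[OF x this]
  note c = seven_cycle_adj[OF x]
  show False
  proof (rule five_far[of w p "x 0" "x 1" "x 4"])
    show "far adj (x 0) (x 4)"
      using walk3_far c(5-7) adj_sym by blast
    show "far adj (x 1) (x 4)"
      using walk3_far c(2-4) by blast
  qed (use w adj_far c(1) far far' adj_V \<open>p \<in> V\<close> seven_cycle_V[OF x] in auto)
qed

end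

subsection \<open>Colouring with the 5-cycle\<close>

context saturated_graph
begin

lemma seven_cycle_nth:
  assumes "adj a b" "adj b c" "adj c d" "adj d e" "adj e f" "adj f g" "adj g a"
  shows "seven_cycle (\<lambda>i. [a, b, c, d, e, f, g] ! (i mod 7))"
proof -
  define x where "x i = [a, b, c, d, e, f, g] ! (i mod 7)" for i
  have "adj (x i) (x (Suc i))" for i
  proof -
    have "i mod 7 \<in> {0, 1, 2, 3, 4, 5, 6}"
      by auto
    then show ?thesis
      using assms by (auto simp: x_def mod_Suc)
  qed
  then show ?thesis
    unfolding seven_cycle_def x_def by simp
qed

text \<open>Otherwise a walk of length 4 from \<open>d\<close> back to \<open>a\<close> closes a
  7-cycle.\<close>

lemma walk3_adj:
  assumes "\<nexists>x. seven_cycle x" "adj a b" "adj b c" "adj c d"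
  shows "adj a d"
proof (rule ccontr)
  assume "\<not> adj a d"
  then have "\<not> adj d a"
    using adj_sym by blast
  moreover have "a \<in> V" "d \<in> V"
    using assms adj_V adj_sym by blast+
  ultimately obtain x y z where "adj d x" "adj x y" "adj y z" "adj z a"
    using walk4 by blast
  then show False
    using seven_cycle_nth assms by blast
qed

text \<open>More than a proper colouring: a homomorphism to the 5-cycle.\<close>

definition five_colouring :: "('a \<Rightarrow> nat) \<Rightarrow> bool" where
  "five_colouring c \<longleftrightarrow>
     (\<forall>u. c u < 5) \<and> (\<forall>u v. adj u v \<longrightarrow> c v = (c u + 1) mod 5 \<or> c u = (c v + 1) mod 5)"

text \<open>An edge \<open>uw\<close> between non-neighbours of \<open>v\<close> would extend a walk
  of length 4 from \<open>v\<close> to \<open>u\<close>; shortening the resulting walk of length 5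
  twice by \<open>walk3_adj\<close> makes \<open>v\<close> adjacent to \<open>w\<close>.\<close>

lemma five_colouring_bipartite:
  assumes no: "\<nexists>x. seven_cycle x" and v: "v \<in> V"
  shows "five_colouring (\<lambda>u. if adj v u then 1 else 0)"
proof -
  have "\<not> adj u w" if vu: "\<not> adj v u" and vw: "\<not> adj v w" for u w
  proof
    assume uw: "adj u w"
    then have "u \<in> V"
      by (rule adj_V)
    then obtain a b c where "adj v a" "adj a b" "adj b c" "adj c u"
      using walk4[OF v _ vu] by blast
    then show False
      using walk3_adj[OF no] uw vw by blast
  qed
  moreover have "\<not> adj u w" if "adj v u" "adj v w" for u w
    using no_triangle[OF that(1)] adj_sym[OF that(2)] by blast
  ultimately have "adj v u \<longleftrightarrow> \<not> adj v w" if "adj u w" for u w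
    using that by metis
  then show ?thesis
    unfolding five_colouring_def by simp
qed

section \<open>Colouring in the presence of a 7-cycle\<close>

context
  fixes x :: "nat \<Rightarrow> 'a"
  assumes x: "seven_cycle x"
begin

lemma x_mod: "x (i mod 7) = x i"
proof (induction i rule: less_induct)
  case (less i)
  show ?case
  proof (cases "i < 7")
    case False
    then obtain j where j: "i = j + 7"
      by (metis add.commute le_add_diff_inverse not_less)
    then show ?thesis
      using less[of j] x unfolding seven_cycle_def by simp
  qed simp
qed

lemmas x_adj = seven_cycle_adj[OF x] seven_cycle_adj[OF x, THEN adj_sym]

lemma dominated:
  assumes "p \<in> V"
  shows "adj p (x 0) \<or> adj p (x 1) \<or> adj p (x 2) \<or> adj p (x 3) \<or> adj p (x 4) \<or>
    adj p (x 5) \<or> adj p (x 6)"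
proof -
  obtain i where i: "adj p (x (i mod 7))"
    using seven_cycle_dominates[OF x assms] by (auto simp: x_mod)
  have "i mod 7 < 7"
    by simp
  then have "i mod 7 \<in> {0, 1, 2, 3, 4, 5, 6}"
    by auto
  then show ?thesis
    using i by auto
qed

lemma chords: "\<not> adj (x 0) (x 2)" "\<not> adj (x 0) (x 3)" "\<not> adj (x 0) (x 4)" "\<not> adj (x 0) (x 5)"
  using x_adj no_triangle no_pentagon by blast+

lemma not_both:
  assumes "far adj a b" "adj p a"
  shows "\<not> adj p b"
  using assms unfolding far_def by blast

lemma x_far:
  "far adj (x 0) (x 1)" "far adj (x 1) (x 2)" "far adj (x 2) (x 3)" "far adj (x 3) (x 4)"
  "far adj (x 4) (x 5)" "far adj (x 5) (x 6)" "far adj (x 6) (x 0)"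
  "far adj (x 0) (x 3)" "far adj (x 1) (x 4)" "far adj (x 2) (x 5)" "far adj (x 3) (x 6)"
  "far adj (x 4) (x 0)" "far adj (x 5) (x 1)" "far adj (x 6) (x 2)"
  using x_adj adj_far walk3_far by blast+

lemma x_wrap: "x 7 = x 0" "x 8 = x 1" "x 9 = x 2" "x 10 = x 3" "x 11 = x 4" "x 12 = x 5" "x 13 = x 6"
  using x_mod[of 7] x_mod[of 8] x_mod[of 9] x_mod[of 10] x_mod[of 11] x_mod[of 12] x_mod[of 13]
  by simp_all

text \<open>How the ends of an edge can attach to the cycle. The first two claims exclude a triangle
  and a pentagon; the third is a long diagonal of the hexagon \<open>p\<close>, \<open>x i\<close>,
  ..., \<open>x (i + 3)\<close>, \<open>q\<close>, whose diagonal from \<open>x i\<close> to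
  \<open>x (i + 3)\<close> would close a pentagon with the rest of the cycle.\<close>

lemma neighbour_types:
  assumes pq: "adj p q"
  shows "\<not> (adj p (x i) \<and> adj q (x i))"
    and "\<not> (adj p (x i) \<and> adj q (x (i + 2)))"
    and "adj p (x i) \<Longrightarrow> adj q (x (i + 3)) \<Longrightarrow> adj p (x (i + 2)) \<or> adj q (x (i + 1))"
proof -
  note c = seven_cycle_adj[OF seven_cycle_shift[OF x, of i], unfolded add_0]
  note c' = c[unfolded add.commute[of _ i]]
  show "\<not> (adj p (x i) \<and> adj q (x i))"
    using pq no_triangle adj_sym by blast
  show "\<not> (adj p (x i) \<and> adj q (x (i + 2)))"
    using pq no_pentagon[of p "x i" "x (i + 1)" "x (i + 2)" q] c' adj_sym by blast
  assume pqx: "adj p (x i)" "adj q (x (i + 3))"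
  have "\<not> adj (x i) (x (i + 3))"
    using no_pentagon[OF c'(4-7)] .
  then show "adj p (x (i + 2)) \<or> adj q (x (i + 1))"
    using no_hex pqx c'(1-3) pq adj_sym unfolding no_hex_def by blast
qed

text \<open>
  \<open>left\<close> is one side of a bipartition of the graph without the neighbours of \<open>x\<^sub>0\<close>: such a vertex is
  adjacent only to \<open>x\<^sub>i\<close> with \<open>i\<close> even, or only with \<open>i\<close> odd, or exactly to \<open>x\<^sub>1\<close> and \<open>x\<^sub>6\<close>.  In the last
  case its side is dictated by the neighbours that it has next to \<open>x\<^sub>2\<close>.
\<close>

definition swing :: "'a \<Rightarrow> bool" where
  "swing p \<longleftrightarrow> (\<exists>q. adj p q \<and> \<not> adj q (x 0) \<and> adj q (x 2))"

definition left :: "'a \<Rightarrow> bool" where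
  "left p \<longleftrightarrow> adj p (x 2) \<or> adj p (x 4) \<or> adj p (x 6) \<and> (\<not> adj p (x 1) \<or> \<not> swing p)"

text \<open>Otherwise \<open>p\<close> and its two neighbours close the path \<open>x\<^sub>2, \<dots>, x\<^sub>5\<close> to a 7-cycle avoiding all neighbours of \<open>x\<^sub>0\<close>.\<close>

lemma swing_not:
  assumes p: "adj p (x 1)" and q: "adj p q" "\<not> adj q (x 0)" "adj q (x 5)"
  shows "\<not> swing p"
proof
  assume "swing p"
  then obtain u where u: "adj p u" "\<not> adj u (x 0)" "adj u (x 2)"
    unfolding swing_def by blast
  define y where "y i = [p, u, x 2, x 3, x 4, x 5, q] ! (i mod 7)" for i
  have "seven_cycle y"
    unfolding y_def using u q x_adj adj_sym by (intro seven_cycle_nth) auto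
  then obtain i where "adj (x 0) (y i)"
    using seven_cycle_dominates adj_V[OF x_adj(1)] by blast
  moreover have "\<not> adj (x 0) p"
    using p x_adj(1) no_triangle adj_sym by blast
  moreover have "\<not> adj (x 0) u" "\<not> adj (x 0) q"
    using u q adj_sym by blast+
  moreover have "i mod 7 \<in> {0, 1, 2, 3, 4, 5, 6}"
    by auto
  ultimately show False
    using chords unfolding y_def by auto
qed

text \<open>With the adjacencies of \<open>p\<close> and \<open>q\<close> to the cycle and the two
  \<open>swing\<close> values as propositional variables, the claim follows from domination, the far
  pairs on the cycle, \<open>neighbour_types\<close> and \<open>swing_not\<close>.\<close>

lemma left_iff:
  assumes pq: "adj p q" and p0: "\<not> adj p (x 0)" and q0: "\<not> adj q (x 0)"
  shows "left p \<longleftrightarrow> \<not> left q"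
proof -
  have qp: "adj q p"
    using pq by (rule adj_sym)
  have t1: "\<not> (adj p (x i) \<and> adj q (x i))" for i
    by (rule neighbour_types[OF pq])
  have t2: "\<not> (adj p (x i) \<and> adj q (x (i + 2)))" "\<not> (adj q (x i) \<and> adj p (x (i + 2)))" for i
    by (rule neighbour_types[OF pq] neighbour_types[OF qp])+
  have t3: "adj p (x i) \<and> adj q (x (i + 3)) \<longrightarrow> adj p (x (i + 2)) \<or> adj q (x (i + 1))"
    "adj q (x i) \<and> adj p (x (i + 3)) \<longrightarrow> adj q (x (i + 2)) \<or> adj p (x (i + 1))" for i
    using neighbour_types(3)[OF pq, of i] neighbour_types(3)[OF qp, of i] by blast+
  have sw: "adj p (x 1) \<and> adj q (x 5) \<longrightarrow> \<not> swing p" "adj q (x 1) \<and> adj p (x 5) \<longrightarrow> \<not> swing q"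
    using swing_not[OF _ pq q0] swing_not[OF _ qp p0] by blast+
  have sw': "adj q (x 2) \<longrightarrow> swing p" "adj p (x 2) \<longrightarrow> swing q"
    using pq qp p0 q0 unfolding swing_def by blast+
  have V: "p \<in> V" "q \<in> V"
    using pq qp adj_V by blast+
  have f: "\<not> (adj r (x 1) \<and> adj r (x 2))" "\<not> (adj r (x 2) \<and> adj r (x 3))" "\<not> (adj r (x 3) \<and> adj r (x 4))"
    "\<not> (adj r (x 4) \<and> adj r (x 5))" "\<not> (adj r (x 5) \<and> adj r (x 6))" "\<not> (adj r (x 1) \<and> adj r (x 4))"
    "\<not> (adj r (x 2) \<and> adj r (x 5))" "\<not> (adj r (x 3) \<and> adj r (x 6))" "\<not> (adj r (x 5) \<and> adj r (x 1))"
    "\<not> (adj r (x 6) \<and> adj r (x 2))" for r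
    using x_far not_both by blast+
  \<comment> \<open>These are the instances whose indices pass 6 and wrap around to the start of the
    cycle.\<close>
  have t2w: "\<not> (adj p (x 5) \<and> adj q (x 0))" "\<not> (adj p (x 6) \<and> adj q (x 1))" "\<not> (adj q (x 6) \<and> adj p (x 1))"
    using t2(1)[of 5] t2(1)[of 6] t2(2)[of 6] by (simp_all add: x_wrap del: One_nat_def)
  have t3w: "adj p (x 5) \<and> adj q (x 1) \<longrightarrow> adj q (x 6)" "adj q (x 5) \<and> adj p (x 1) \<longrightarrow> adj p (x 6)"
    "adj p (x 6) \<and> adj q (x 2) \<longrightarrow> adj p (x 1)" "adj q (x 6) \<and> adj p (x 2) \<longrightarrow> adj q (x 1)"
    using t3(1)[of 5] t3(2)[of 5] t3(1)[of 6] t3(2)[of 6] p0 q0 by (simp_all add: x_wrap del: One_nat_def)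
  have t3': "adj p (x 1) \<and> adj q (x 4) \<longrightarrow> adj p (x 3) \<or> adj q (x 2)"
    "adj q (x 1) \<and> adj p (x 4) \<longrightarrow> adj q (x 3) \<or> adj p (x 2)"
    "adj p (x 2) \<and> adj q (x 5) \<longrightarrow> adj p (x 4) \<or> adj q (x 3)"
    "adj q (x 2) \<and> adj p (x 5) \<longrightarrow> adj q (x 4) \<or> adj p (x 3)"
    "adj p (x 3) \<and> adj q (x 6) \<longrightarrow> adj p (x 5) \<or> adj q (x 4)"
    "adj q (x 3) \<and> adj p (x 6) \<longrightarrow> adj q (x 5) \<or> adj p (x 4)"
    using t3(1)[of 1] t3(2)[of 1] t3(1)[of 2] t3(2)[of 2] t3(1)[of 3] t3(2)[of 3] by (simp_all del: One_nat_def)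
  have t2': "\<not> (adj p (x 1) \<and> adj q (x 3))" "\<not> (adj q (x 1) \<and> adj p (x 3))"
    "\<not> (adj p (x 2) \<and> adj q (x 4))" "\<not> (adj q (x 2) \<and> adj p (x 4))"
    "\<not> (adj p (x 3) \<and> adj q (x 5))" "\<not> (adj q (x 3) \<and> adj p (x 5))"
    "\<not> (adj p (x 4) \<and> adj q (x 6))" "\<not> (adj q (x 4) \<and> adj p (x 6))"
    using t2(1)[of 1] t2(2)[of 1] t2(1)[of 2] t2(2)[of 2] t2(1)[of 3] t2(2)[of 3] t2(1)[of 4] t2(2)[of 4]
    by (simp_all del: One_nat_def)
  show ?thesis
    using p0 q0 sw sw' dominated[OF V(1)] dominated[OF V(2)] f[of p] f[of q]
      t1[of 1] t1[of 2] t1[of 3] t1[of 4] t1[of 5] t1[of 6] t2w t3w t2' t3'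
    unfolding left_def by argo
qed

definition near :: "'a \<Rightarrow> bool" where
  "near p \<longleftrightarrow> (\<exists>q. adj p q \<and> adj q (x 0))"

text \<open>In cyclic order the classes are the neighbours of \<open>x 0\<close>, left near, right
  far-off, left far-off and right near vertices. The pairs of classes 1 and 4 span no edge because
  two adjacent near vertices would lie on a pentagon through \<open>x 0\<close>.\<close>

definition colour :: "'a \<Rightarrow> nat" where
  "colour p =
     (if adj p (x 0) then 0
      else if left p then (if near p then 1 else 3)
      else (if near p then 4 else 2))"

lemma near_not_near:
  assumes "adj p q" "near p"
  shows "\<not> near q"
proof
  assume "near q"
  then obtain r s where "adj p r" "adj r (x 0)" "adj q s" "adj s (x 0)"
    using assms(2) unfolding near_def by blast
  then show False
    using no_pentagon[of p q s "x 0" r] assms(1) adj_sym by blast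
qed

lemma five_colouring_colour: "five_colouring colour"
  unfolding five_colouring_def
proof (intro conjI allI impI)
  show "colour p < 5" for p
    by (simp add: colour_def)
next
  fix p q
  assume pq: "adj p q"
  then have qp: "adj q p"
    by (rule adj_sym)
  have "\<not> (adj p (x 0) \<and> adj q (x 0))"
    using neighbour_types(1)[OF pq] .
  moreover have "adj p (x 0) \<longrightarrow> near q" "adj q (x 0) \<longrightarrow> near p"
    using pq qp unfolding near_def by blast+
  moreover have "\<not> (near p \<and> near q)"
    using near_not_near[OF pq] by blast
  moreover have "\<not> adj p (x 0) \<and> \<not> adj q (x 0) \<longrightarrow> (left p \<longleftrightarrow> \<not> left q)"
    using left_iff[OF pq] by blast
  ultimately show "colour q = (colour p + 1) mod 5 \<or> colour p = (colour q + 1) mod 5"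
    unfolding colour_def by (auto split: if_split)
qed

end

theorem ex_five_colouring: "V \<noteq> {} \<Longrightarrow> \<exists>c. five_colouring c"
  using five_colouring_bipartite five_colouring_colour by blast

end

subsection \<open>The orientation induced by a colouring\<close>

context saturated_graph
begin

context
  fixes c :: "'a \<Rightarrow> nat"
  assumes c: "five_colouring c"
begin

definition arcs5 :: "('a \<times> 'a) set" where
  "arcs5 = {(u, v). adj u v \<and> c v = (c u + 1) mod 5}"

lemma adj_arcs5: "adj u v \<Longrightarrow> (u, v) \<in> arcs5 \<or> (v, u) \<in> arcs5"
  using c adj_sym unfolding five_colouring_def arcs5_def by blast

lemma colour_step:
  assumes "adj u v"
  obtains "(u, v) \<in> arcs5" "c v = (c u + 1) mod 5" | "c v = (c u + 4) mod 5"
proof -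
  have lt: "c v < 5" "c u < 5"
    using c unfolding five_colouring_def by blast+
  show thesis
  proof (cases "(u, v) \<in> arcs5")
    case False
    then have "c u = (c v + 1) mod 5"
      using adj_arcs5[OF assms] unfolding arcs5_def by blast
    then have "c v = (c u + 4) mod 5"
      using lt by presburger
    then show ?thesis by (rule that)
  qed (use that in \<open>auto simp: arcs5_def\<close>)
qed

lemma colour_relpow: "(u, v) \<in> arcs5 ^^ n \<Longrightarrow> c v = (c u + n) mod 5"
proof (induction n arbitrary: v)
  case 0
  then show ?case
    using c unfolding five_colouring_def by simp
next
  case (Suc n)
  then obtain w where "(u, w) \<in> arcs5 ^^ n" "(w, v) \<in> arcs5"
    by auto
  then show ?case
    using Suc.IH[of w] by (simp add: arcs5_def mod_Suc_eq)
qed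

text \<open>Each step of a walk of length 4 from \<open>v\<close> to \<open>u\<close> changes the
  colour by 1 or -1. With \<open>k\<close> forward steps the total is \<open>2 * k - 4\<close>,
  which must be -1 modulo 5; so \<open>k = 4\<close>.\<close>

lemma back_path:
  assumes "u \<in> V" "v \<in> V" "\<not> adj u v" and uv: "c v = (c u + 1) mod 5"
  shows "(v, u) \<in> arcs5 ^^ 4"
proof -
  have "\<not> adj v u"
    using assms(3) adj_sym by blast
  then obtain x y z where w: "adj v x" "adj x y" "adj y z" "adj z u"
    using walk4[OF assms(2,1)] by blast
  have "c u < 5"
    using c unfolding five_colouring_def by blast
  have step: "\<exists>s\<in>{1, 4}. c b = (c a + s) mod 5 \<and> (s = 1 \<longrightarrow> (a, b) \<in> arcs5)" if "adj a b" for a b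
    by (rule colour_step[OF that]) auto
  obtain s1 where s1: "s1 \<in> {1, 4}" "c x = (c v + s1) mod 5" "s1 = 1 \<longrightarrow> (v, x) \<in> arcs5"
    using step[OF w(1)] by blast
  obtain s2 where s2: "s2 \<in> {1, 4}" "c y = (c x + s2) mod 5" "s2 = 1 \<longrightarrow> (x, y) \<in> arcs5"
    using step[OF w(2)] by blast
  obtain s3 where s3: "s3 \<in> {1, 4}" "c z = (c y + s3) mod 5" "s3 = 1 \<longrightarrow> (y, z) \<in> arcs5"
    using step[OF w(3)] by blast
  obtain s4 where s4: "s4 \<in> {1, 4}" "c u = (c z + s4) mod 5" "s4 = 1 \<longrightarrow> (z, u) \<in> arcs5"
    using step[OF w(4)] by blast
  have "c u = ((((((c u + 1) mod 5) + s1) mod 5 + s2) mod 5 + s3) mod 5 + s4) mod 5"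
    by (simp only: uv[symmetric] s1(2)[symmetric] s2(2)[symmetric] s3(2)[symmetric] s4(2)[symmetric])
  also have "\<dots> = (c u + (1 + s1 + s2 + s3 + s4)) mod 5"
    by (simp add: mod_simps add_ac)
  finally have "c u = (c u + (1 + s1 + s2 + s3 + s4)) mod 5" .
  moreover have "S mod 5 = 0" if "k = (k + S) mod 5" "k < 5" for k S :: nat
    using that by presburger
  ultimately have "(1 + s1 + s2 + s3 + s4) mod 5 = 0"
    using \<open>c u < 5\<close> by blast
  then have "s1 = 1 \<and> s2 = 1 \<and> s3 = 1 \<and> s4 = 1"
    using s1(1) s2(1) s3(1) s4(1) by auto
  then have "(v, x) \<in> arcs5 \<and> (x, y) \<in> arcs5 \<and> (y, z) \<in> arcs5 \<and> (z, u) \<in> arcs5"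
    using s1(3) s2(3) s3(3) s4(3) by blast
  then show ?thesis
    by (auto simp: numeral_eq_Suc relcomp_unfold)
qed

text \<open>If the colour of \<open>v\<close> exceeds that of \<open>g 0\<close> by
  \<open>d\<close>, its neighbours on the walk have index \<open>d + 1\<close>,
  \<open>d + 4\<close>, \<open>d + 6\<close> or \<open>d + 9\<close> modulo 10. The first two are
  joined by a walk of length 3, as are the last two, so \<open>v\<close> has at most one of each
  pair.\<close>

lemma no_ten_cycle:
  assumes g: "\<And>i. i < 10 \<Longrightarrow> (g i, g (Suc i)) \<in> arcs5" and g10: "g 10 = g 0"
  shows False
proof -
  have gV: "g ` {..<10} \<subseteq> V"
    using g adj_V unfolding arcs5_def by blast
  have adj: "adj (g i) (g (Suc i))" if "i < 10" for i
    using g[OF that] unfolding arcs5_def by blast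
  have a: "adj (g 0) (g 1)" "adj (g 1) (g 2)" "adj (g 2) (g 3)" "adj (g 3) (g 4)" "adj (g 4) (g 5)"
    "adj (g 5) (g 6)" "adj (g 6) (g 7)" "adj (g 7) (g 8)" "adj (g 8) (g 9)" "adj (g 9) (g 0)"
    using adj[of 0] adj[of 1] adj[of 2] adj[of 3] adj[of 4] adj[of 5] adj[of 6] adj[of 7] adj[of 8] adj[of 9] g10
    by (simp_all add: eval_nat_numeral)
  have far: "far adj (g 0) (g 3)" "far adj (g 1) (g 4)" "far adj (g 2) (g 5)" "far adj (g 3) (g 6)"
    "far adj (g 4) (g 7)" "far adj (g 5) (g 8)" "far adj (g 6) (g 9)" "far adj (g 7) (g 0)"
    "far adj (g 8) (g 1)" "far adj (g 9) (g 2)"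
    using a walk3_far by blast+
  have col: "c (g i) = (c (g 0) + i) mod 5" if "i \<le> 10" for i
  proof (rule colour_relpow)
    show "(g 0, g i) \<in> arcs5 ^^ i"
      unfolding relpow_fun_conv using g that by (intro exI[of _ g]) auto
  qed
  obtain v where "v \<in> V" and v: "10 < 5 * (\<Sum>i<10. if adj v (g i) then 1 else 0 :: int)"
    using heavy_vertex[OF _ gV, of "\<lambda>_. 1"] by auto
  have lt: "c v < 5" "c (g 0) < 5"
    using c unfolding five_colouring_def by blast+
  define d where "d = (c v + 5 - c (g 0)) mod 5"
  have d: "c v = (c (g 0) + d) mod 5"
    unfolding d_def using lt by (simp add: mod_simps)
  have cancel: "i mod 5 = j mod 5" if "(a + i) mod 5 = (a + j) mod 5" for a i j :: nat
  proof -
    have "(4 * a + (a + i)) mod 5 = (4 * a + (a + j)) mod 5"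
      by (rule mod_add_cong[OF refl that])
    moreover have "4 * a + (a + k) = k + 5 * a" for k
      by simp
    ultimately show ?thesis
      by (simp only: mod_mult_self2)
  qed
  have A: "i mod 5 = (d + 1) mod 5 \<or> i mod 5 = (d + 4) mod 5" if "adj v (g i)" "i \<le> 10" for i
  proof (rule colour_step[OF that(1)])
    assume "c (g i) = (c v + 1) mod 5"
    then show ?thesis
      using cancel[of "c (g 0)" i "d + 1"] col[OF that(2)] d by (simp add: mod_simps add.assoc)
  next
    assume "c (g i) = (c v + 4) mod 5"
    then show ?thesis
      using cancel[of "c (g 0)" i "d + 4"] col[OF that(2)] d by (simp add: mod_simps add.assoc)
  qed
  have f: "\<not> (adj v (g 0) \<and> adj v (g 3))" "\<not> (adj v (g 1) \<and> adj v (g 4))" "\<not> (adj v (g 2) \<and> adj v (g 5))"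
    "\<not> (adj v (g 3) \<and> adj v (g 6))" "\<not> (adj v (g 4) \<and> adj v (g 7))" "\<not> (adj v (g 5) \<and> adj v (g 8))"
    "\<not> (adj v (g 6) \<and> adj v (g 9))" "\<not> (adj v (g 7) \<and> adj v (g 0))" "\<not> (adj v (g 8) \<and> adj v (g 1))"
    "\<not> (adj v (g 9) \<and> adj v (g 2))"
    using far unfolding far_def by blast+
  have N: "\<not> adj v (g i)" if "i mod 5 \<noteq> (d + 1) mod 5" "i mod 5 \<noteq> (d + 4) mod 5" "i \<le> 10" for i
    using A that by blast
  have ten: "{..<10} = {0, 1, 2, 3, 4, 5, 6, 7, 8, 9 :: nat}"
    by auto
  define b where "b i = (if adj v (g i) then 1 else 0 :: int)" for i
  have sum: "10 < 5 * (b 0 + b 1 + b 2 + b 3 + b 4 + b 5 + b 6 + b 7 + b 8 + b 9)"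
    using v unfolding ten b_def[symmetric] by simp
  have z: "b i = 0" if "i mod 5 \<noteq> (d + 1) mod 5" "i mod 5 \<noteq> (d + 4) mod 5" "i \<le> 10" for i
    using N[OF that] by (simp add: b_def)
  have le: "b 0 + b 3 \<le> 1" "b 1 + b 4 \<le> 1" "b 2 + b 5 \<le> 1" "b 3 + b 6 \<le> 1" "b 4 + b 7 \<le> 1"
    "b 5 + b 8 \<le> 1" "b 6 + b 9 \<le> 1" "b 7 + b 0 \<le> 1" "b 8 + b 1 \<le> 1" "b 9 + b 2 \<le> 1"
    using f by (simp_all add: b_def)
  have "d < 5"
    by (simp add: d_def)
  then consider "d = 0" | "d = 1" | "d = 2" | "d = 3" | "d = 4"
    by linarith
  then show False
  proof cases
    case 1
    then have "b 0 = 0" "b 2 = 0" "b 3 = 0" "b 5 = 0" "b 7 = 0" "b 8 = 0"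
      by (simp_all add: z)
    then show False
      using sum le(2) le(7) by simp
  next
    case 2
    then have "b 1 = 0" "b 3 = 0" "b 4 = 0" "b 6 = 0" "b 8 = 0" "b 9 = 0"
      by (simp_all add: z)
    then show False
      using sum le(3) le(8) by simp
  next
    case 3
    then have "b 0 = 0" "b 2 = 0" "b 4 = 0" "b 5 = 0" "b 7 = 0" "b 9 = 0"
      by (simp_all add: z)
    then show False
      using sum le(4) le(9) by simp
  next
    case 4
    then have "b 0 = 0" "b 1 = 0" "b 3 = 0" "b 5 = 0" "b 6 = 0" "b 8 = 0"
      by (simp_all add: z)
    then show False
      using sum le(5) le(10) by simp
  next
    case 5
    then have "b 1 = 0" "b 2 = 0" "b 4 = 0" "b 6 = 0" "b 7 = 0" "b 9 = 0"
      by (simp_all add: z)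
    then show False
      using sum le(1) le(6) by simp
  qed
qed

text \<open>Colours force the length \<open>m\<close> of a shortest closed directed walk to be a
  multiple of 5, and 5 itself would be a pentagon; so \<open>m\<close> is at least 10.\<close>

lemma acyclic_arcs5: "acyclic arcs5"
proof (rule ccontr)
  assume "\<not> ?thesis"
  then have ex: "\<exists>m. 0 < m \<and> (\<exists>x. (x, x) \<in> arcs5 ^^ m)"
    unfolding acyclic_def trancl_power by blast
  define m where "m = (LEAST m. 0 < m \<and> (\<exists>x. (x, x) \<in> arcs5 ^^ m))"
  have "0 < m" and "\<exists>x. (x, x) \<in> arcs5 ^^ m"
    using LeastI_ex[OF ex] unfolding m_def by blast+
  then obtain x where xm: "(x, x) \<in> arcs5 ^^ m"
    by blast
  have least: "m \<le> l" if "0 < l" "(z, z) \<in> arcs5 ^^ l" for l z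
    unfolding m_def using that by (intro Least_le) blast
  obtain f where f: "f 0 = x" "f m = x" "\<And>i. i < m \<Longrightarrow> (f i, f (Suc i)) \<in> arcs5"
    using xm unfolding relpow_fun_conv by blast
  have adj: "adj (f i) (f (Suc i))" if "i < m" for i
    using f(3)[OF that] unfolding arcs5_def by blast
  have "c x < 5"
    using c unfolding five_colouring_def by blast
  then have "m mod 5 = 0"
    using colour_relpow[OF xm] by presburger
  moreover have "m \<noteq> 5"
  proof
    assume "m = 5"
    then show False
      using no_pentagon[of "f 0" "f 1" "f 2" "f 3" "f 4"] adj[of 0] adj[of 1] adj[of 2] adj[of 3] adj[of 4] f(1,2)
      by (simp add: eval_nat_numeral)
  qed
  ultimately have "10 \<le> m"
    using \<open>0 < m\<close> by presburger
  \<comment> \<open>Six arcs raise the colour by 1, like a single arc. An edge from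
    \<open>f 0\<close> to \<open>f 6\<close> would thus be an arc that shortens the closed walk by
    5; without it \<open>back_path\<close> returns in 4 arcs, 10 in all.\<close>
  have six: "(f 0, f 6) \<in> arcs5 ^^ 6"
    unfolding relpow_fun_conv using f(3) \<open>10 \<le> m\<close> by (intro exI[of _ f]) auto
  then have col: "c (f 6) = (c (f 0) + 1) mod 5"
    using colour_relpow[OF six] by presburger
  show False
  proof (cases "adj (f 0) (f 6)")
    case True
    then have "(f 0, f 6) \<in> arcs5"
      using col unfolding arcs5_def by blast
    moreover have "(f (i + 6), f (Suc i + 6)) \<in> arcs5" if "i < m - 6" for i
      using f(3)[of "i + 6"] that by simp
    then have "(f 6, f 0) \<in> arcs5 ^^ (m - 6)"
      unfolding relpow_fun_conv using f(1,2) \<open>10 \<le> m\<close> by (intro exI[of _ "\<lambda>i. f (i + 6)"]) simp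
    ultimately have "(f 0, f 0) \<in> arcs5 ^^ Suc (m - 6)"
      by (rule relpow_Suc_I2)
    then have "m \<le> Suc (m - 6)"
      by (rule least[rotated]) simp
    then show False
      using \<open>10 \<le> m\<close> by simp
  next
    case False
    have "f 0 \<in> V" "f 6 \<in> V"
      using adj[of 0] adj[of 6] adj_V \<open>10 \<le> m\<close> by auto
    then have "(f 6, f 0) \<in> arcs5 ^^ 4"
      using back_path False col by blast
    then have "(f 0, f 0) \<in> arcs5 ^^ (6 + 4)"
      unfolding relpow_add using six by blast
    then obtain g where "g 0 = f 0" "g 10 = f 0" "\<And>i. i < 10 \<Longrightarrow> (g i, g (Suc i)) \<in> arcs5"
      unfolding relpow_fun_conv by auto
    then show False
      using no_ten_cycle[of g] by simp
  qed
qed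

text \<open>Acyclicity makes \<open>h\<close> increase strictly along arcs, so that
  \<open>5 * h v + c v\<close> grows along each arc, and by 1 modulo 5. The direction matters: a
  decrease would leave residue 4 in the absolute value.\<close>

lemma ex_integer_map:
  "\<exists>f :: 'a \<Rightarrow> nat. (\<forall>v. f v < 5 * card V + 5) \<and> (\<forall>u v. adj u v \<longrightarrow> \<bar>int (f u) - int (f v)\<bar> mod 5 = 1)"
proof -
  define h where "h v = card {u. (u, v) \<in> arcs5\<^sup>+}" for v
  have sub: "{u. (u, v) \<in> arcs5\<^sup>+} \<subseteq> V" for v
  proof
    fix u
    assume "u \<in> {u. (u, v) \<in> arcs5\<^sup>+}"
    then obtain w where "(u, w) \<in> arcs5"
      by (auto dest: tranclD)
    then show "u \<in> V"
      using adj_V unfolding arcs5_def by blast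
  qed
  have h_le: "h v \<le> card V" for v
    unfolding h_def by (rule card_mono[OF finite_V sub])
  have h_less: "h u < h v" if "(u, v) \<in> arcs5" for u v
    unfolding h_def
  proof (rule psubset_card_mono)
    show "finite {w. (w, v) \<in> arcs5\<^sup>+}"
      using sub finite_V by (rule finite_subset)
    have "(u, u) \<notin> arcs5\<^sup>+"
      using acyclic_arcs5 unfolding acyclic_def by blast
    then show "{w. (w, u) \<in> arcs5\<^sup>+} \<subset> {w. (w, v) \<in> arcs5\<^sup>+}"
      using that by (auto intro: trancl_into_trancl)
  qed
  define f where "f v = 5 * h v + c v" for v
  have lt: "c v < 5" for v
    using c unfolding five_colouring_def by blast
  have "f v < 5 * card V + 5" for v
    using h_le[of v] lt[of v] unfolding f_def by linarith
  moreover have step: "\<bar>int (f u) - int (f v)\<bar> mod 5 = 1 \<and> \<bar>int (f v) - int (f u)\<bar> mod 5 = 1"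
    if uv: "(u, v) \<in> arcs5" for u v
  proof -
    obtain k where k: "h v = h u + k + 1"
      using less_imp_Suc_add[OF h_less[OF uv]] by auto
    have "c v = (c u + 1) mod 5"
      using uv unfolding arcs5_def by blast
    then have "c v = c u + 1 \<or> c u = 4 \<and> c v = 0"
      using lt[of u] by presburger
    \<comment> \<open>When the colour drops from 4 to 0, the increase of \<open>h\<close> by at
      least 1 still keeps the difference positive.\<close>
    then have "int (f v) - int (f u) = 5 * int (k + 1) + 1 \<or> int (f v) - int (f u) = 5 * int k + 1"
      unfolding f_def k by auto
    then show ?thesis
      by (auto simp: abs_minus_commute)
  qed
  ultimately show ?thesis
    using adj_arcs5 by blast
qed

end

end

subsection \<open>Edge-maximal supergraphs\<close>

context dense_graph
begin

definition adj_plus :: "'a \<Rightarrow> 'a \<Rightarrow> 'a \<Rightarrow> 'a \<Rightarrow> bool" where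
  "adj_plus a b u v \<longleftrightarrow> adj u v \<or> u = a \<and> v = b \<or> u = b \<and> v = a"

lemma adj_plus_sym: "adj_plus a b u v \<Longrightarrow> adj_plus a b v u"
  using adj_sym unfolding adj_plus_def by blast

context
  fixes a b
  assumes V: "a \<in> V" "b \<in> V" and ab: "\<not> adj a b"
    and no4: "\<nexists>x y z. adj a x \<and> adj x y \<and> adj y z \<and> adj z b"
begin

lemma ex_neighbour: "\<exists>n. adj a n"
proof -
  have "{u. adj u a} \<noteq> {}"
    using degree[OF V(1)] by (metis card.empty mult_0_right not_less0)
  then show ?thesis
    using adj_sym by blast
qed

text \<open>With a neighbour \<open>n\<close> of \<open>a\<close>, the detour from \<open>a\<close>
  to \<open>n\<close> and back pads shorter walks to the forbidden length 4.\<close>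

lemma basic: "a \<noteq> b" "\<not> adj b a" "\<not> adj u u" "\<not> (adj a u \<and> adj u b)"
  using ex_neighbour ab no4 no_triangle adj_sym by blast+

lemma no_triangle_plus: "adj_plus a b p q \<Longrightarrow> adj_plus a b q r \<Longrightarrow> \<not> adj_plus a b r p"
proof
  assume pqr: "adj_plus a b p q" "adj_plus a b q r" "adj_plus a b r p"
  have *: False if "adj_plus a b b w" "adj_plus a b w a" for w
    using that basic adj_sym unfolding adj_plus_def by blast
  have **: False if "adj_plus a b a w" "adj_plus a b w b" for w
    using *[of w] that adj_plus_sym by blast
  have "\<not> (adj p q \<and> adj q r \<and> adj r p)"
    using no_triangle by blast
  then consider "p = a \<and> q = b \<or> p = b \<and> q = a" | "q = a \<and> r = b \<or> q = b \<and> r = a"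
    | "r = a \<and> p = b \<or> r = b \<and> p = a"
    using pqr unfolding adj_plus_def by blast
  then show False
    by cases (use pqr * ** in blast)+
qed

text \<open>A further use of the new edge would leave a triangle, excluded by
  \<open>no_triangle_plus\<close>. Hence all four steps are old edges and form, read backwards, the
  walk forbidden by \<open>no4\<close>.\<close>

lemma no_path_plus:
  assumes "adj_plus a b b q" "adj_plus a b q r" "adj_plus a b r s" "adj_plus a b s a"
  shows False
proof -
  have "adj b q"
    using assms no_triangle_plus[of a r s] basic(1) unfolding adj_plus_def[of _ _ b q] by blast
  moreover have "adj s a"
    using assms no_triangle_plus[of b q r] basic(1) unfolding adj_plus_def[of _ _ s a] by blast
  moreover have "adj q r" "adj r s"
    using assms(2,3) calculation basic adj_sym unfolding adj_plus_def by blast+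
  ultimately show False
    using no4 adj_sym by blast
qed

lemma no_pentagon_plus:
  assumes "adj_plus a b p q" "adj_plus a b q r" "adj_plus a b r s" "adj_plus a b s t"
  shows "\<not> adj_plus a b t p"
proof
  assume tp: "adj_plus a b t p"
  have *: False if "u = b \<and> w = a \<or> u = a \<and> w = b"
      "adj_plus a b u x" "adj_plus a b x y" "adj_plus a b y z" "adj_plus a b z w" for u x y z w
    using that no_path_plus[of x y z] no_path_plus[of z y x] adj_plus_sym by blast
  have "\<not> (adj p q \<and> adj q r \<and> adj r s \<and> adj s t \<and> adj t p)"
    using no_pentagon by blast
  then consider "q = b \<and> p = a \<or> q = a \<and> p = b" | "r = b \<and> q = a \<or> r = a \<and> q = b"
    | "s = b \<and> r = a \<or> s = a \<and> r = b" | "t = b \<and> s = a \<or> t = a \<and> s = b"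
    | "p = b \<and> t = a \<or> p = a \<and> t = b"
    using assms tp unfolding adj_plus_def by blast
  then show False
  proof cases
    case 1 then show False using *[of q p r s t] assms tp by blast
  next
    case 2 then show False using *[of r q s t p] assms tp by blast
  next
    case 3 then show False using *[of s r t p q] assms tp by blast
  next
    case 4 then show False using *[of t s p q r] assms tp by blast
  next
    case 5 then show False using *[of p t q r s] assms tp by blast
  qed
qed

lemma dense_graph_plus: "dense_graph V (adj_plus a b)"
proof
  show "finite V"
    by (rule finite_V)
  show "u \<in> V" if "adj_plus a b u v" for u v
    using that V adj_V unfolding adj_plus_def by blast
  show "adj_plus a b v u" if "adj_plus a b u v" for u v
    using that by (rule adj_plus_sym)
  show "card V < 5 * card {u. adj_plus a b u v}" if "v \<in> V" for v
  proof -
    have "{u. adj_plus a b u v} \<subseteq> V"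
      using V adj_V unfolding adj_plus_def by blast
    then have "card {u. adj u v} \<le> card {u. adj_plus a b u v}"
      using finite_V by (intro card_mono) (auto intro: finite_subset simp: adj_plus_def)
    then show ?thesis
      using degree[OF that] by linarith
  qed
qed (fact no_triangle_plus no_pentagon_plus)+

end

end

text \<open>Take an inclusion-maximal relation in the finite set of dense supergraphs on
  \<open>V\<close>; a pair that violates \<open>walk4\<close> could be added to it.\<close>

lemma ex_saturated:
  assumes "dense_graph V adj"
  obtains adj' where "saturated_graph V adj'" "\<And>u v. adj u v \<Longrightarrow> adj' u v"
proof -
  define A where "A = {E. {(u, v). adj u v} \<subseteq> E \<and> dense_graph V (\<lambda>u v. (u, v) \<in> E)}"
  have "E \<subseteq> V \<times> V" if "E \<in> A" for E
  proof -
    interpret dense_graph V "\<lambda>u v. (u, v) \<in> E"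
      using that by (simp add: A_def)
    show ?thesis
    proof (rule subrelI)
      fix u v
      assume uv: "(u, v) \<in> E"
      show "(u, v) \<in> V \<times> V"
        using adj_V[OF uv] adj_V[OF adj_sym[OF uv]] by simp
    qed
  qed
  moreover have "finite (V \<times> V)"
    using assms by (simp add: dense_graph_def)
  ultimately have "finite A"
    by (meson PowI finite_Pow_iff finite_subset subsetI)
  moreover have "{(u, v). adj u v} \<in> A"
    using assms by (simp add: A_def)
  ultimately obtain E where E: "E \<in> A" and max: "\<And>F. F \<in> A \<Longrightarrow> E \<subseteq> F \<Longrightarrow> E = F"
    using finite_has_maximal[of A] by blast
  interpret dense_graph V "\<lambda>u v. (u, v) \<in> E"
    using E by (simp add: A_def)
  have "saturated_graph V (\<lambda>u v. (u, v) \<in> E)"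
  proof
    fix a b
    assume V: "a \<in> V" "b \<in> V" and ab: "(a, b) \<notin> E"
    show "\<exists>x y z. (a, x) \<in> E \<and> (x, y) \<in> E \<and> (y, z) \<in> E \<and> (z, b) \<in> E"
    proof (rule ccontr)
      assume no: "\<not> ?thesis"
      define F where "F = {(u, v). adj_plus a b u v}"
      have "dense_graph V (\<lambda>u v. (u, v) \<in> F)"
        using dense_graph_plus[OF V ab no] by (simp add: F_def)
      moreover have "E \<subseteq> F"
        by (auto simp: F_def adj_plus_def)
      ultimately have "E = F"
        using E by (intro max) (auto simp: A_def)
      then show False
        using ab by (auto simp: F_def adj_plus_def)
    qed
  qed
  then show thesis
    using that E by (auto simp: A_def)
qed

lemma ex_homomorphism:
  assumes "dense_graph V adj"
  shows "\<exists>f :: 'a \<Rightarrow> nat. (\<forall>v. f v < 5 * card V + 5) \<and> (\<forall>u v. adj u v \<longrightarrow> \<bar>int (f u) - int (f v)\<bar> mod 5 = 1)"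
proof (cases "V = {}")
  case True
  then have "\<not> adj u v" for u v
    using assms by (auto simp: dense_graph_def)
  then show ?thesis
    by (intro exI[of _ "\<lambda>_. 0"]) auto
next
  case False
  obtain adj' where "saturated_graph V adj'" and sub: "\<And>u v. adj u v \<Longrightarrow> adj' u v"
    using ex_saturated[OF assms] by blast
  then interpret saturated_graph V adj'
    by simp
  show ?thesis
    using ex_five_colouring[OF False] ex_integer_map sub by blast
qed

section \<open>Translation between pair graphs and adjacency relations\<close>

lemma contains_copyI:
  assumes "3 \<le> l" and len: "length xs = l" "distinct xs" "set xs \<subseteq> pverts G" and sym: "symmetric (with_proj G)"
    and "\<And>i. i < l \<Longrightarrow> (xs ! i, xs ! (Suc i mod l)) \<in> parcs G"
  shows "contains_copy (cycle_graph l) G"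
  unfolding contains_copy_def
proof (intro exI[of _ "nth xs"] conjI)
  have "(v, u) \<in> parcs G" if "(u, v) \<in> parcs G" for u v
    using sym that by (auto simp: symmetric_def dest: symD)
  then show "graph_hom (cycle_graph l) G (nth xs)"
    using assms(6) len unfolding graph_hom_def cycle_graph_def by (auto simp: subset_iff)
  show "inj_on (nth xs) (pverts (cycle_graph l))"
    using len by (auto simp: cycle_graph_def inj_on_def nth_eq_iff_index_eq)
qed

theorem theorem1p3:
  fixes G :: "'a pair_pre_digraph" and n :: nat
  assumes "pair_graph G"
    and "card (pverts G) = n"
    and "\<not> contains_copy (cycle_graph 3) G"
    and "\<not> contains_copy (cycle_graph 5) G"
    and "real (min_degree G) > real n / 5"
  shows "\<exists>k\<ge>1. homomorphic_to G (F_graph k)"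
proof -
  interpret pair_graph G
    by (rule assms(1))
  define adj where "adj u v \<longleftrightarrow> (u, v) \<in> parcs G" for u v
  have adj_V: "u \<in> pverts G \<and> v \<in> pverts G" if "adj u v" for u v
    using that in_arcsD1 in_arcsD2 by (auto simp: adj_def)
  have adj_sym: "adj v u" if "adj u v" for u v
    using that arcs_symmetric by (auto simp: adj_def)
  have irrefl: "\<not> adj u u" for u
    using no_loops[of "(u, u)"] by (auto simp: adj_def)
  have tri: "\<not> adj c a" if "adj a b" "adj b c" for a b c
  proof
    assume ca: "adj c a"
    have "distinct [a, b, c]"
      using that ca irrefl by auto
    moreover have "set [a, b, c] \<subseteq> pverts G"
      using adj_V[OF that(1)] adj_V[OF ca] by simp
    moreover have "([a, b, c] ! i, [a, b, c] ! (Suc i mod 3)) \<in> parcs G" if "i < 3" for i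
    proof -
      have "i \<in> {0, 1, 2}"
        using that by auto
      then show ?thesis
        using \<open>adj a b\<close> \<open>adj b c\<close> ca unfolding adj_def by auto
    qed
    ultimately have "contains_copy (cycle_graph 3) G"
      by (intro contains_copyI[where xs = "[a, b, c]"] sym_arcs) simp_all
    then show False
      using assms(3) by blast
  qed
  have pent: "\<not> adj e a" if "adj a b" "adj b c" "adj c d" "adj d e" for a b c d e
  proof
    assume ea: "adj e a"
    \<comment> \<open>If two vertices two steps apart coincided, the other three edges would form a
      triangle.\<close>
    have "a \<noteq> c" "a \<noteq> d" "b \<noteq> d" "b \<noteq> e" "c \<noteq> e"
      using that ea tri adj_sym by metis+
    moreover have "a \<noteq> b" "b \<noteq> c" "c \<noteq> d" "d \<noteq> e" "e \<noteq> a"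
      using that ea irrefl by metis+
    ultimately have "distinct [a, b, c, d, e]"
      by auto
    moreover have "set [a, b, c, d, e] \<subseteq> pverts G"
      using adj_V[OF that(1)] adj_V[OF that(3)] adj_V[OF ea] by simp
    moreover have "([a, b, c, d, e] ! i, [a, b, c, d, e] ! (Suc i mod 5)) \<in> parcs G" if "i < 5" for i
    proof -
      have "i \<in> {0, 1, 2, 3, 4}"
        using that by auto
      then show ?thesis
        using \<open>adj a b\<close> \<open>adj b c\<close> \<open>adj c d\<close> \<open>adj d e\<close> ea unfolding adj_def by auto
    qed
    ultimately have "contains_copy (cycle_graph 5) G"
      by (intro contains_copyI[where xs = "[a, b, c, d, e]"] sym_arcs) simp_all
    then show False
      using assms(4) by blast
  qed
  have deg: "card (pverts G) < 5 * card {u. adj u v}" if v: "v \<in> pverts G" for v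
  proof -
    have "out_arcs (with_proj G) v = Pair v ` {u. adj u v}"
      using arcs_symmetric by (auto simp: out_arcs_def adj_def)
    then have "out_degree (with_proj G) v = card {u. adj u v}"
      unfolding out_degree_def by (simp add: card_image inj_on_def)
    \<comment> \<open>A vertex \<open>v\<close> is given here, so the unspecified minimum over the
      empty set never enters.\<close>
    moreover have "min_degree G \<le> out_degree (with_proj G) v"
      unfolding min_degree_def using v finite_verts by (intro Min_le) auto
    ultimately show ?thesis
      using assms(2,5) by linarith
  qed
  have "dense_graph (pverts G) adj"
  proof
    show "finite (pverts G)"
      by (rule finite_verts)
  next
    fix u v assume "adj u v" then show "u \<in> pverts G" using adj_V by blast
  next
    fix u v assume "adj u v" then show "adj v u" by (rule adj_sym)
  next
    fix a b c assume "adj a b" "adj b c" then show "\<not> adj c a" by (rule tri)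
  next
    fix a b c d e assume "adj a b" "adj b c" "adj c d" "adj d e" then show "\<not> adj e a" by (rule pent)
  next
    fix v assume "v \<in> pverts G" then show "card (pverts G) < 5 * card {u. adj u v}" by (rule deg)
  qed
  then obtain f :: "'a \<Rightarrow> nat" where f: "\<And>v. f v < 5 * card (pverts G) + 5"
    and step: "\<And>u v. adj u v \<Longrightarrow> \<bar>int (f u) - int (f v)\<bar> mod 5 = 1"
    using ex_homomorphism by blast
  \<comment> \<open>The shift by 1 is needed as the vertices of \<open>F_graph\<close> start at 1.
    They end at \<open>5 * card (pverts G) + 7\<close> for this index, above the bound on
    \<open>f v + 1\<close>.\<close>
  have "graph_hom G (F_graph (card (pverts G) + 2)) (\<lambda>v. f v + 1)"
    unfolding graph_hom_def
  proof (intro conjI ballI)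
    have le: "f v + 1 \<le> 5 * (card (pverts G) + 2) - 3" for v
      using f[of v] by simp
    then show "(\<lambda>v. f v + 1) ` pverts G \<subseteq> pverts (F_graph (card (pverts G) + 2))"
      by (auto simp: F_graph_def)
    fix e
    assume "e \<in> parcs G"
    then show "case e of (u, v) \<Rightarrow> (f u + 1, f v + 1) \<in> parcs (F_graph (card (pverts G) + 2))"
      using le step by (cases e) (simp add: F_graph_def adj_def)
  qed
  then show ?thesis
    unfolding homomorphic_to_def by (intro exI[of _ "card (pverts G) + 2"]) auto
qed

end
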